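(* Let $p>3$ be a prime. Then \begin{align*} &\sum_{n=0}^{p-1}\big((2n+1)^3-5(2n+1)\big)\frac{S_n^2}{32^n}\equiv -4(-1)^{\frac{p-1}2}p^2+\big(24((-1)^{\frac{p-1}2}-1)-12E_{p-3}\big)p^4\pmod{p^5},\\ &\sum_{n=0}^{p-1}(18n^3-21n^2-18n-4)\frac{S_n^2}{64^n}\equiv 18p^4-(-1)^{\frac{p-1}2}p^2(18p^2+6p-2)2^{1-p}+6p^4E_{p-3}\pmod{p^5},\\ &\sum_{n=0}^{p-1}(18n^3+75n^2+78n+25)\frac{S_n^2}{16^n}\equiv 45p^4-4(-1)^{\frac{p-1}2}p^2(9p^2-3p-1)2^{p-1}+12p^4E_{p-3}\pmod{p^5} \end{align*} and \begin{align*} &\sum_{n=0}^{p-1}\left(10634085n^4+45622368n^3+70689360n^2+47911968n+12084400\right)S_n^2\\ &\equiv -1024(-1)^{\frac{p-1}2}p^2(1089p^2-1023p+299)32^{p-1}+(12458160-918528E_{p-3})p^4\pmod{p^5}. \end{align*}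
   Context: $S_n=\sum_{k=0}^n\binom nk\binom{2k}k\binom{2n-2k}{n-k}$. $\{E_n\}$ are the Euler numbers given by $E_{2n-1}=0$, $E_0=1$ and $E_{2n}=-\sum_{k=0}^{n-1}\binom{2n}{2k}E_{2k}$ for $n\ge 1$. A congruence $\alpha\equiv\beta\pmod{p^m}$ between rational numbers with denominators prime to $p$ means that $(\alpha-\beta)/p^m$ is a rational number with denominator prime to $p$. *)

theory Defs
  imports Complex_Main "HOL-Computational_Algebra.Primes"
begin

definition S_seq :: "nat \<Rightarrow> nat" where
  "S_seq n = (\<Sum>k=0..n. (n choose k) * ((2 * k) choose k) * ((2 * n - 2 * k) choose (n - k)))"

fun euler_number :: "nat \<Rightarrow> int" where
  "euler_number n =
     (if odd n then 0
      else if n = 0 then 1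
      else - (\<Sum>k<n div 2. int (n choose (2 * k)) * euler_number (2 * k)))"

declare euler_number.simps [simp del]

lemma euler_number_0: "euler_number 0 = 1"
  by (subst euler_number.simps) simp

lemma euler_number_odd: "n \<ge> 1 \<Longrightarrow> euler_number (2 * n - 1) = 0"
  by (subst euler_number.simps) simp

lemma euler_number_even:
  assumes "n \<ge> 1"
  shows "euler_number (2 * n) =
           - (\<Sum>k=0..n - 1. int ((2 * n) choose (2 * k)) * euler_number (2 * k))"
proof -
  have "{..<n} = {0..n - 1}"
    using assms by auto
  then show ?thesis
    using assms by (subst euler_number.simps) simp
qed

(* quotient_of yields the fraction in lowest terms with positive denominator. *)
definition denom_prime_to :: "nat \<Rightarrow> rat \<Rightarrow> bool" where
  "denom_prime_to p r \<longleftrightarrow> coprime (snd (quotient_of r)) (int p)"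

(* The congruence is only meaningful between rationals with denominators prime to p,
   so this is part of the relation. *)
definition rat_cong :: "nat \<Rightarrow> nat \<Rightarrow> rat \<Rightarrow> rat \<Rightarrow> bool" where
  "rat_cong p m a b \<longleftrightarrow>
     denom_prime_to p a \<and> denom_prime_to p b \<and> denom_prime_to p ((a - b) / of_nat p ^ m)"

end

theory Submission
  imports Defs "HOL-Computational_Algebra.Formal_Power_Series" "HOL-Number_Theory.Residues"
begin

text \<open>
  The sequence satisfies the recurrence
  (n+1)^2 S(n+1) = 4(3n^2+3n+1) S(n) - 32 n^2 S(n-1).  For each of the four pairs of a polynomial q
  and a modulus base M there is a quadratic form in S(n) and S(n-1), divided by M^(n-1), whose
  forward difference is q(n) S(n)^2 / M^n (\<open>S_telescope\<close>).  Evaluated at n = p, the form is p^2 times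
  a p^2 S(p)^2 + b(p) S(p) S(p-1) + c p^2 S(p-1)^2,
  so the sums are known modulo p^5 as soon as S(p) and S(p-1) are known modulo p^3.

  These two residues come from a second formula for S(n),
  the sum over k of C(2k,k)^2 C(k,n-k) (-4)^(n-k) (\<open>S_seq_alternating\<close>).  Let h = (p-1)/2 and
  let \<open>\<epsilon>\<close> = (-1)^h.  In S(p-1) only the indices k \<ge> h contribute.  The term k = h is (-4)^h C(p-1,h)^2, which Morley's congruence evaluates modulo p^3.
  The terms with k > h contain the square of a central binomial coefficient that p divides, so they
  matter only modulo p after removal of p^2; there they become multiples of
  (-1)^i / (i^2 C(h,i)) with i = k - h.  The sum of these over i has a closed form, valid for every
  h, in terms of the sums of 1/j^2 and (-1)^j/j^2 (\<open>alternating_sum_inverse_square_binomial\<close>).  The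
  first of these vanishes modulo p, and the second is the Euler number E(p-3) up to a factor
  2 \<open>\<epsilon>\<close>.  The result is
  S(p-1) \<equiv> \<open>\<epsilon>\<close> 32^(p-1) + p^2 E(p-3) modulo p^3.  In S(p) the term k = p is C(2p,p)^2 \<equiv> 4 by
  Wolstenholme's congruence, the others reduce to the same sum, and
  S(p) \<equiv> 4 + 8 \<open>\<epsilon>\<close> p^2 E(p-3) modulo p^3.
\<close>

unbundle fps_syntax

section \<open>The recurrence and the alternating formula\<close>

text \<open>
  The operator x d/dx multiplies the n-th coefficient by n, so a recurrence with polynomial
  coefficients is a differential equation written with it, and products and compositions of power
  series can be handled by the Leibniz and chain rules.
\<close>
definition euler_op :: "rat fps \<Rightarrow> rat fps" where
  "euler_op f = fps_X * fps_deriv f"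

lemma euler_op_nth [simp]: "euler_op f $ n = of_nat n * f $ n"
  by (cases n) (simp_all add: euler_op_def)

lemma euler_op_add: "euler_op (f + g) = euler_op f + euler_op g"
  by (simp add: euler_op_def algebra_simps)

lemma euler_op_mult: "euler_op (f * g) = euler_op f * g + f * euler_op g"
  by (simp add: euler_op_def algebra_simps)

lemma euler_op_X: "euler_op fps_X = fps_X"
  by (simp add: euler_op_def)

lemma euler_op_numeral: "euler_op (numeral k) = 0"
  by (simp add: euler_op_def)

text \<open>At n = 0 the factor n^2 cancels the term in which the subtraction n - 1 is truncated.\<close>
definition S_recurrence :: "(nat \<Rightarrow> rat) \<Rightarrow> bool" where
  "S_recurrence a \<longleftrightarrow>
     (\<forall>n. (of_nat n + 1)^2 * a (Suc n) =
          4 * (3 * of_nat n ^ 2 + 3 * of_nat n + 1) * a n - 32 * of_nat n ^ 2 * a (n - 1))"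

lemma S_recurrence_unique:
  assumes "S_recurrence a" "S_recurrence b" "a 0 = b 0"
  shows "a n = b n"
proof (induction n rule: less_induct)
  case (less n)
  show ?case
  proof (cases n)
    case 0
    then show ?thesis using assms(3) by simp
  next
    case (Suc m)
    have "(of_nat m + 1)^2 * a (Suc m) = (of_nat m + 1)^2 * b (Suc m)"
      using assms(1,2) less[of m] less[of "m - 1"] Suc
      unfolding S_recurrence_def by simp
    moreover have "(of_nat m + 1 :: rat) ^ 2 \<noteq> 0"
      by (metis Suc_eq_plus1 of_nat_Suc of_nat_neq_0 power_not_zero add.commute)
    ultimately show ?thesis using Suc by simp
  qed
qed

lemma central_binomial_Suc:
  "of_nat (Suc k) * of_nat ((2 * Suc k) choose Suc k) = (2 * (2 * of_nat k + 1) * of_nat ((2 * k) choose k) :: rat)"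
proof -
  have "(Suc k * ((2 * Suc k) choose Suc k)) = 2 * Suc (2*k) * ((2 * k) choose k)"
    (is ?nat)
  proof -
    have "Suc k * (Suc (Suc (2*k)) choose Suc k) = Suc (Suc (2*k)) * (Suc (2*k) choose k)"
      by (rule Suc_times_binomial)
    also have "(Suc (2*k) choose k) = (Suc (2*k) choose (Suc k))"
      using binomial_symmetric[of k "Suc (2*k)"] by (simp add: Suc_diff_le mult_2)
    finally have "Suc k * (Suc (Suc (2*k)) choose Suc k) = 2 * (Suc k * (Suc (2*k) choose Suc k))"
      by simp
    also have "Suc k * (Suc (2*k) choose Suc k) = Suc (2*k) * ((2*k) choose k)"
      by (rule Suc_times_binomial)
    finally show ?thesis by simp
  qed
  then have "rat_of_nat (Suc k * ((2 * Suc k) choose Suc k)) = of_nat (2 * Suc (2*k) * ((2 * k) choose k))"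
    by (simp only:)
  then show ?thesis by (simp add: algebra_simps)
qed

text \<open>
  Divided by n!, the sequence is the self-convolution of C(2k,k)/k!, whose generating function g
  satisfies a differential equation of order two.  The recurrence is the equation of order three
  that its square satisfies as a consequence.
\<close>
lemma S_recurrence_S_seq: "S_recurrence (\<lambda>n. of_nat (S_seq n))"
proof -
  define g :: "rat fps" where "g = Abs_fps (\<lambda>k. of_nat ((2 * k) choose k) / fact k)"
  define q where "q = euler_op g"
  have q: "euler_op q = 2 * fps_X * (2 * q + g)"
  proof (rule fps_ext)
    fix n
    show "euler_op q $ n = (2 * fps_X * (2 * q + g)) $ n"
    proof (cases n)
      case (Suc m)
      have "(2 * fps_X * (2 * q + g)) $ Suc m = (fps_X * (2 * (2 * q + g))) $ Suc m"
        by (simp only: mult_ac)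
      also have "\<dots> = (2 * (2 * q + g)) $ m" by simp
      also have "\<dots> = 2 * (2 * of_nat m + 1) * g $ m"
        by (simp add: q_def numeral_fps_const) (simp add: algebra_simps)
      finally have rhs: "(2 * fps_X * (2 * q + g)) $ Suc m = 2 * (2 * of_nat m + 1) * g $ m" .
      have "euler_op q $ Suc m = of_nat (Suc m) * (of_nat (Suc m) * of_nat ((2 * Suc m) choose Suc m)) / fact (Suc m)"
        by (simp add: q_def g_def del: of_nat_Suc fact_Suc)
      also have "\<dots> = of_nat (Suc m) * (2 * (2 * of_nat m + 1) * of_nat ((2 * m) choose m)) / fact (Suc m)"
        by (simp only: central_binomial_Suc)
      also have "\<dots> = 2 * (2 * of_nat m + 1) * g $ m"
        unfolding g_def fps_nth_Abs_fps fact_Suc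
        by (simp add: mult.assoc del: of_nat_Suc)
      finally show ?thesis using rhs Suc by simp
    qed (simp add: q_def g_def)
  qed
  define s where "s = g * g"
  have s1: "euler_op s = 2 * g * q"
    by (simp add: s_def euler_op_mult q_def)
  have s2: "euler_op (2 * g * q) = 2 * q * q + 8 * fps_X * g * q + 4 * fps_X * g * g"
    by (simp add: euler_op_mult euler_op_numeral q q_def [symmetric]) (simp add: algebra_simps)
  have s3: "euler_op (2 * q * q + 8 * fps_X * g * q + 4 * fps_X * g * g) = 24 * fps_X * q * q + 24 * fps_X * g * q
      + 32 * fps_X * fps_X * g * q + 16 * fps_X * fps_X * g * g + 4 * fps_X * g * g"
    by (simp add: euler_op_mult euler_op_add euler_op_X euler_op_numeral q q_def [symmetric])
       (simp add: algebra_simps)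
  have ode: "euler_op (euler_op (euler_op s)) =
      fps_X * (12 * euler_op (euler_op s) + 12 * euler_op s + 4 * s)
      - fps_X * (fps_X * (32 * euler_op s + 32 * s))"
    unfolding s1 s2 s3 unfolding s_def by (simp add: algebra_simps)
  have S: "of_nat (S_seq n) = fact n * s $ n" for n
  proof -
    have "of_nat ((n choose i) * ((2 * i) choose i) * ((2 * n - 2 * i) choose (n - i)))
        = (fact n * (g $ i * g $ (n - i)) :: rat)" if "i \<in> {0..n}" for i
      using that by (simp add: g_def binomial_fact[of i n] diff_mult_distrib2)
    then show ?thesis
      unfolding S_seq_def s_def fps_mult_nth sum_distrib_left of_nat_sum by (intro sum.cong refl)
  qed
  show ?thesis
    unfolding S_recurrence_def
  proof
    fix n
    have ode_n: "euler_op (euler_op (euler_op s)) $ Suc n =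
       (fps_X * (12 * euler_op (euler_op s) + 12 * euler_op s + 4 * s)
      - fps_X * (fps_X * (32 * euler_op s + 32 * s))) $ Suc n"
      by (simp only: ode)
    show "(of_nat n + 1)^2 * of_nat (S_seq (Suc n)) = 
        (4 * (3 * of_nat n ^ 2 + 3 * of_nat n + 1) * of_nat (S_seq n)
           - 32 * of_nat n ^ 2 * of_nat (S_seq (n - 1)) :: rat)"
    proof (cases n)
      case 0
      then show ?thesis
        using ode_n by (simp add: numeral_fps_const S)
    next
      case (Suc m)
      define N :: rat where "N = of_nat m"
      have "(N + 2) * ((N + 2) * ((N + 2) * s $ Suc (Suc m)))
          = (12 * ((N + 1) * ((N + 1) * s $ Suc m)) + 12 * ((N + 1) * s $ Suc m) + 4 * s $ Suc m)
          - (32 * (N * s $ m) + 32 * s $ m)"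
        using ode_n unfolding Suc by (simp add: numeral_fps_const N_def add.commute)
      then have "(N + 1) * fact m * ((N + 2) * ((N + 2) * ((N + 2) * s $ Suc (Suc m))))
          = (N + 1) * fact m * ((12 * ((N + 1) * ((N + 1) * s $ Suc m)) + 12 * ((N + 1) * s $ Suc m) + 4 * s $ Suc m)
          - (32 * (N * s $ m) + 32 * s $ m))"
        by (simp only:)
      moreover have "of_nat n = N + 1" by (simp add: Suc N_def)
      moreover have "of_nat (S_seq (Suc n)) = (N + 2) * (N + 1) * fact m * s $ Suc (Suc m)"
        "of_nat (S_seq n) = (N + 1) * fact m * s $ Suc m" "of_nat (S_seq (n - 1)) = fact m * s $ m"
        by (simp_all add: S Suc N_def algebra_simps)
      ultimately show ?thesis
        by (simp add: power2_eq_square algebra_simps)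
    qed
  qed
qed

lemma fps_nth_power_X_minus_4_X2:
  "((fps_X - 4 * fps_X ^ 2) ^ k :: rat fps) $ n =
     (if k \<le> n then of_nat (k choose (n - k)) * (- 4) ^ (n - k) else 0)"
proof -
  have y: "(fps_X - 4 * fps_X ^ 2 :: rat fps) = fps_X * (1 + fps_const (- 4) * fps_X)"
    by (simp add: power2_eq_square algebra_simps numeral_fps_const flip: fps_const_neg)
  have "((1 + fps_const (- 4) * fps_X) ^ k :: rat fps) $ j = of_nat (k choose j) * (- 4) ^ j" for j
  proof -
    have "(1 + fps_const (- 4) * fps_X :: rat fps) ^ k
       = (\<Sum>i\<le>k. of_nat (k choose i) * (fps_const (- 4) * fps_X) ^ i)"
      using binomial_ring[of "fps_const (- 4) * fps_X :: rat fps" 1 k] by (simp add: add.commute)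
    also have "\<dots> $ j = (\<Sum>i\<le>k. if i = j then of_nat (k choose i) * (-4) ^ i else 0)"
      unfolding fps_sum_nth
      by (intro sum.cong refl)
         (simp add: power_mult_distrib fps_const_power fps_of_nat [symmetric] del: fps_const_neg)
    finally show ?thesis by (simp add: sum.delta)
  qed
  then show ?thesis
    by (simp add: y power_mult_distrib fps_X_power_mult_nth del: fps_const_neg)
qed

text \<open>
  The right-hand side is the coefficient of x^n in f(x - 4x^2), where f is the generating function
  of C(2k,k)^2.  The differential equation of f, transported along y = x - 4x^2, says that these
  coefficients satisfy the recurrence of S, and both sequences start with 1.  The transport works
  because 1 - 16y = (1 - 8x)^2 is a square.
\<close>
lemma S_seq_alternating:
  "of_nat (S_seq n) =
     (\<Sum>k=0..n. of_nat ((2 * k) choose k) ^ 2 * of_nat (k choose (n - k)) * (- 4 :: rat) ^ (n - k))"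
proof -
  define f :: "rat fps" where "f = Abs_fps (\<lambda>k. of_nat ((2 * k) choose k) ^ 2)"
  define y :: "rat fps" where "y = fps_X - 4 * fps_X ^ 2"
  have y0: "y $ 0 = 0" by (simp add: y_def)
  have ode_f: "euler_op (euler_op f) = fps_X * (16 * euler_op (euler_op f) + 16 * euler_op f + 4 * f)"
  proof (rule fps_ext)
    fix n
    show "euler_op (euler_op f) $ n = (fps_X * (16 * euler_op (euler_op f) + 16 * euler_op f + 4 * f)) $ n"
    proof (cases n)
      case (Suc m)
      have "euler_op (euler_op f) $ Suc m = (of_nat (Suc m) * of_nat ((2 * Suc m) choose Suc m)) ^ 2"
        by (simp add: f_def power2_eq_square del: of_nat_Suc)
      also have "\<dots> = (2 * (2 * of_nat m + 1) * of_nat ((2 * m) choose m)) ^ 2"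
        by (simp only: central_binomial_Suc)
      also have "\<dots> = (fps_X * (16 * euler_op (euler_op f) + 16 * euler_op f + 4 * f)) $ Suc m"
        by (simp add: f_def power2_eq_square numeral_fps_const algebra_simps)
      finally show ?thesis using Suc by simp
    qed (simp add: f_def)
  qed
  define F Q W where "F = f oo y" and "Q = euler_op f oo y" and "W = euler_op (euler_op f) oo y"
  have "W = y * (16 * W + 16 * Q + 4 * F)"
    unfolding W_def F_def Q_def
    by (subst ode_f, simp add: fps_compose_mult_distrib fps_compose_add_distrib y0 numeral_fps_const)
  then have W: "W * (1 - 8 * fps_X) ^ 2 = 4 * y * (4 * Q + F)"
    by (simp add: y_def power2_eq_square algebra_simps)
  have chain: "(1 - 4 * fps_X) * euler_op (a oo y) = (1 - 8 * fps_X) * (euler_op a oo y)" for a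
  proof -
    have "(1 - 4 * fps_X) * euler_op (a oo y) = y * (fps_deriv a oo y) * fps_deriv y"
      by (simp add: euler_op_def fps_compose_deriv y0) (simp add: y_def power2_eq_square algebra_simps)
    also have "y * (fps_deriv a oo y) = euler_op a oo y"
      by (simp add: euler_op_def fps_compose_mult_distrib y0)
    also have "fps_deriv y = 1 - 8 * fps_X"
      by (simp add: y_def power2_eq_square algebra_simps)
    finally show ?thesis by (simp add: algebra_simps)
  qed
  have F1: "(1 - 4 * fps_X) * euler_op F = (1 - 8 * fps_X) * Q"
    unfolding F_def Q_def by (rule chain)
  have Q1: "(1 - 4 * fps_X) * euler_op Q = (1 - 8 * fps_X) * W"
    unfolding W_def Q_def by (rule chain)
  have "euler_op ((1 - 4 * fps_X) * euler_op F) = euler_op ((1 - 8 * fps_X) * Q)"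
    by (simp only: F1)
  then have F2: "(1 - 4 * fps_X) * euler_op (euler_op F) =
      4 * fps_X * euler_op F - 8 * fps_X * Q + (1 - 8 * fps_X) * euler_op Q"
    by (simp add: euler_op_def algebra_simps)
  define D where "D = (1 - 4 * fps_X) * (1 - 8 * fps_X) * euler_op (euler_op F)
     + (64 * fps_X ^ 2 - 12 * fps_X) * euler_op F - 4 * fps_X * (1 - 8 * fps_X) * F"
  have "(1 - 4 * fps_X) * D = (1 - 8 * fps_X) * (1 - 4 * fps_X) * ((1 - 4 * fps_X) * euler_op (euler_op F))
     + (64 * fps_X ^ 2 - 12 * fps_X) * ((1 - 4 * fps_X) * euler_op F) - 4 * fps_X * (1 - 8 * fps_X) * (1 - 4 * fps_X) * F"
    by (simp add: D_def algebra_simps)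
  also have "\<dots> = (1 - 8 * fps_X) * (4 * fps_X * ((1 - 4 * fps_X) * euler_op F)
       - 8 * fps_X * (1 - 4 * fps_X) * Q + (1 - 8 * fps_X) * ((1 - 4 * fps_X) * euler_op Q))
     + (64 * fps_X ^ 2 - 12 * fps_X) * ((1 - 4 * fps_X) * euler_op F) - 4 * fps_X * (1 - 8 * fps_X) * (1 - 4 * fps_X) * F"
    unfolding F2 by (simp add: algebra_simps)
  also have "\<dots> = (1 - 8 * fps_X) * (4 * fps_X * (1 - 8 * fps_X) * Q
       - 8 * fps_X * (1 - 4 * fps_X) * Q + W * (1 - 8 * fps_X) ^ 2)
     + (64 * fps_X ^ 2 - 12 * fps_X) * (1 - 8 * fps_X) * Q - 4 * fps_X * (1 - 8 * fps_X) * (1 - 4 * fps_X) * F"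
    unfolding F1 Q1 by (simp add: power2_eq_square algebra_simps)
  also have "\<dots> = 0"
    unfolding W y_def by (simp add: power2_eq_square algebra_simps)
  finally have "(1 - 4 * fps_X) * D = 0" .
  moreover have "(1 - 4 * fps_X :: rat fps) $ 0 = 1" by simp
  then have "(1 - 4 * fps_X :: rat fps) \<noteq> 0" by (metis fps_zero_nth zero_neq_one)
  ultimately have D: "D = 0" by simp
  have "S_recurrence (\<lambda>n. F $ n)"
    unfolding S_recurrence_def
  proof
    fix n
    have "euler_op (euler_op F) - fps_X * (12 * euler_op (euler_op F) + 12 * euler_op F + 4 * F)
       + fps_X * (fps_X * (32 * euler_op (euler_op F) + 64 * euler_op F + 32 * F)) = D"
      by (simp add: D_def power2_eq_square algebra_simps)
    then have zero: "(euler_op (euler_op F) - fps_X * (12 * euler_op (euler_op F) + 12 * euler_op F + 4 * F)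
       + fps_X * (fps_X * (32 * euler_op (euler_op F) + 64 * euler_op F + 32 * F))) $ Suc n = 0"
      by (simp add: D)
    show "(of_nat n + 1)^2 * F $ Suc n =
          4 * (3 * of_nat n ^ 2 + 3 * of_nat n + 1) * F $ n - 32 * of_nat n ^ 2 * F $ (n - 1)"
    proof (cases n)
      case 0
      then show ?thesis
        using zero by (simp add: numeral_fps_const)
    next
      case (Suc m)
      define N :: rat where "N = of_nat m"
      have "(N + 2) * ((N + 2) * F $ Suc (Suc m))
          - (12 * ((N + 1) * ((N + 1) * F $ Suc m)) + 12 * ((N + 1) * F $ Suc m) + 4 * F $ Suc m)
          + (32 * (N * (N * F $ m)) + 64 * (N * F $ m) + 32 * F $ m) = 0"
        using zero unfolding Suc by (simp add: numeral_fps_const N_def add.commute)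
      moreover have "of_nat n = N + 1" by (simp add: Suc N_def)
      ultimately show ?thesis
        by (simp add: Suc power2_eq_square algebra_simps)
    qed
  qed
  moreover have "of_nat (S_seq 0) = F $ 0"
    by (simp add: S_seq_def F_def f_def)
  ultimately have "of_nat (S_seq n) = F $ n"
    by (rule S_recurrence_unique[OF S_recurrence_S_seq, where b = "\<lambda>n. F $ n"])
  also have "\<dots> = (\<Sum>k=0..n. of_nat ((2 * k) choose k) ^ 2 * (y ^ k) $ n)"
    by (simp add: F_def fps_compose_nth f_def)
  finally show ?thesis
    by (simp add: y_def fps_nth_power_X_minus_4_X2 mult.assoc)
qed

section \<open>Telescoping sums of squares\<close>

text \<open>
  The weights n^4 and n^2 in the form T let every S(n+1) in T(n+1) appear as (n+1)^2 S(n+1), which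
  the recurrence rewrites as the linear combination z of S(n) and S(n-1).  What remains of
  T(n+1) = q(n) S(n)^2 + M T(n) is an identity between polynomials in N = n and the independent
  variables x = S(n) and y = S(n-1).  The same weights make T(0) vanish, so the sum has no
  initial term.
\<close>
lemma S_telescope:
  fixes a b\<^sub>0 b\<^sub>1 b\<^sub>2 c M :: rat and q :: "rat \<Rightarrow> rat"
  assumes M: "M \<noteq> 0"
    and step: "\<And>N x y :: rat. let z = 4 * (3 * N ^ 2 + 3 * N + 1) * x - 32 * N ^ 2 * y in
      a * z ^ 2 + (b\<^sub>0 + b\<^sub>1 * (N + 1) + b\<^sub>2 * (N + 1) ^ 2) * z * x + c * (N + 1) ^ 4 * x ^ 2
      = q N * x ^ 2 + M * (a * N ^ 4 * x ^ 2 + (b\<^sub>0 + b\<^sub>1 * N + b\<^sub>2 * N ^ 2) * N ^ 2 * x * y + c * N ^ 4 * y ^ 2)"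
  defines "T \<equiv> \<lambda>n. a * of_nat n ^ 4 * of_nat (S_seq n) ^ 2
      + (b\<^sub>0 + b\<^sub>1 * of_nat n + b\<^sub>2 * of_nat n ^ 2) * of_nat n ^ 2 * of_nat (S_seq n) * of_nat (S_seq (n - 1))
      + c * of_nat n ^ 4 * of_nat (S_seq (n - 1)) ^ 2"
  shows "(\<Sum>n=0..N. q (of_nat n) * (of_nat (S_seq n) ^ 2 / M ^ n)) = T (Suc N) / M ^ N"
proof -
  have T_Suc: "T (Suc n) = q (of_nat n) * of_nat (S_seq n) ^ 2 + M * T n" for n
  proof -
    define z :: rat where "z = (of_nat n + 1) ^ 2 * of_nat (S_seq (Suc n))"
    have z: "z = 4 * (3 * of_nat n ^ 2 + 3 * of_nat n + 1) * of_nat (S_seq n) - 32 * of_nat n ^ 2 * of_nat (S_seq (n - 1))"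
      using S_recurrence_S_seq unfolding S_recurrence_def z_def by blast
    have "T (Suc n) = a * z ^ 2 + (b\<^sub>0 + b\<^sub>1 * (of_nat n + 1) + b\<^sub>2 * (of_nat n + 1) ^ 2) * z * of_nat (S_seq n)
        + c * (of_nat n + 1) ^ 4 * of_nat (S_seq n) ^ 2"
      by (simp add: T_def z_def add.commute power_mult_distrib flip: power_mult)
    also have "\<dots> = q (of_nat n) * of_nat (S_seq n) ^ 2 + M * T n"
      using step[of "of_nat n" "of_nat (S_seq n)" "of_nat (S_seq (n - 1))"]
      unfolding Let_def z T_def by simp
    finally show ?thesis .
  qed
  show ?thesis
  proof (induction N)
    case 0
    show ?case using T_Suc[of 0] by (simp add: T_def)
  next
    case (Suc N)
    then show ?case
      using M by (simp add: T_Suc[of "Suc N"] field_simps)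
  qed
qed

section \<open>Products and quotients of factorials\<close>

text \<open>Both sides equal (2n)!/n!.\<close>
lemma prod_odd_numbers:
  "2 ^ n * (\<Prod>j=1..n. 2 * of_nat n + 1 - 2 * of_nat j) = (\<Prod>j=1..n. 2 * of_nat n + 1 - of_nat j :: rat)"
proof -
  have odd: "fact (2 * m) = 2 ^ m * fact m * (\<Prod>j=1..m. 2 * of_nat j - 1 :: rat)" for m
    by (induction m) (simp_all add: algebra_simps)
  have "fact (m + n) = fact m * (\<Prod>j=1..n. of_nat m + of_nat j :: rat)" for m
    by (induction n) (simp_all add: algebra_simps)
  from this[of n] have "fact n * (\<Prod>j=1..n. of_nat n + of_nat j :: rat) = fact (2 * n)"
    by (simp add: mult_2)
  also have "\<dots> = fact n * (2 ^ n * (\<Prod>j=1..n. 2 * of_nat j - 1))"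
    unfolding odd by (simp only: mult_ac)
  finally have *: "(\<Prod>j=1..n. of_nat n + of_nat j) = 2 ^ n * (\<Prod>j=1..n. 2 * of_nat j - 1 :: rat)"
    by simp
  have "(\<Prod>j=1..n. of_nat n + of_nat j :: rat) = (\<Prod>j=1..n. 2 * of_nat n + 1 - of_nat j)"
    by (rule prod.reindex_bij_witness[of _ "\<lambda>j. n + 1 - j" "\<lambda>j. n + 1 - j"]) (auto simp: of_nat_diff)
  moreover have "(\<Prod>j=1..n. 2 * of_nat j - 1 :: rat) = (\<Prod>j=1..n. 2 * of_nat n + 1 - 2 * of_nat j)"
    by (rule prod.reindex_bij_witness[of _ "\<lambda>j. n + 1 - j" "\<lambda>j. n + 1 - j"]) (auto simp: of_nat_diff)
  ultimately show ?thesis using * by simp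
qed

lemma binomial_Suc_right: "Suc j * (k choose Suc j) = (k - j) * (k choose j)"
  using binomial_absorption[of j k] binomial_absorb_comp[of k j] by simp

section \<open>Euler numbers as alternating power sums\<close>
lemma sum_even_indices:
  fixes f :: "nat \<Rightarrow> 'a :: comm_monoid_add"
  assumes "\<And>i. odd i \<Longrightarrow> f i = 0"
  shows "(\<Sum>i=0..2 * m. f i) = (\<Sum>k=0..m. f (2 * k))"
  by (induction m) (simp_all add: assms)

lemma euler_number_egf:
  "Abs_fps (\<lambda>n. of_int (euler_number n) / fact n) * (fps_exp 1 + fps_exp (- 1)) = (2 :: rat fps)"
proof (rule fps_ext)
  fix n
  define f :: "nat \<Rightarrow> rat"
    where "f i = of_nat (n choose i) * of_int (euler_number i) * (1 + (- 1) ^ (n - i))" for i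
  have odd0: "euler_number i = 0" if "odd i" for i
    using that by (subst euler_number.simps) simp
  have "fact n * (Abs_fps (\<lambda>n. of_int (euler_number n) / fact n) * (fps_exp 1 + fps_exp (- 1))) $ n
      = sum f {0..n}"
    unfolding fps_mult_nth sum_distrib_left
    by (intro sum.cong refl) (simp add: f_def binomial_fact field_simps)
  also have "\<dots> = (if n = 0 then 2 else 0)"
  proof (cases "odd n")
    case True
    have "f i = 0" if "i \<in> {0..n}" for i
      using that True by (cases "odd i") (simp_all add: f_def odd0)
    then have "sum f {0..n} = 0" by (intro sum.neutral) blast
    then show ?thesis using True by (auto elim: oddE)
  next
    case False
    then obtain m where n: "n = 2 * m" by (auto elim: evenE)
    have "sum f {0..n} = (\<Sum>k=0..m. f (2 * k))"
      unfolding n by (rule sum_even_indices) (simp add: f_def odd0)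
    also have "\<dots> = 2 * of_int (\<Sum>k=0..m. int ((2 * m) choose (2 * k)) * euler_number (2 * k))"
      unfolding of_int_sum sum_distrib_left
      by (intro sum.cong refl) (simp add: f_def n flip: diff_mult_distrib2)
    also have "(\<Sum>k=0..m. int ((2 * m) choose (2 * k)) * euler_number (2 * k)) = (if m = 0 then 1 else 0)"
      using euler_number_even[of m] by (cases m) (simp_all add: euler_number_0)
    finally show ?thesis by (simp add: n)
  qed
  finally show "(Abs_fps (\<lambda>n. of_int (euler_number n) / fact n) * (fps_exp 1 + fps_exp (- 1))) $ n = (2 :: rat fps) $ n"
    by (auto simp: numeral_fps_const split: if_splits)
qed

text \<open>
  Multiplying the alternating sum of exp((2k+1)t) by exp(t) + exp(-t) telescopes to 1 + exp(2Nt),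
  and dividing by exp(t) + exp(-t) is multiplication by half of the exponential generating function
  of the Euler numbers.
\<close>
lemma alternating_odd_power_sum:
  assumes "odd N"
  shows "2 * (\<Sum>k<N. (- 1) ^ k * (2 * of_nat k + 1 :: rat) ^ m) = of_int (euler_number m) +
     (\<Sum>i=0..m. of_nat (m choose i) * of_int (euler_number i) * (2 * of_nat N) ^ (m - i))"
proof -
  define E :: "rat fps" where "E = Abs_fps (\<lambda>n. of_int (euler_number n) / fact n)"
  define A :: "rat fps" where "A = (\<Sum>k<N. fps_const ((- 1) ^ k) * fps_exp (2 * of_nat k + 1))"
  have "(\<Sum>k<n. fps_const ((- 1) ^ k) * fps_exp (2 * of_nat k + 1)) * (fps_exp 1 + fps_exp (- 1))
      = 1 - fps_const ((- 1) ^ n) * (fps_exp (2 * of_nat n) :: rat fps)" for n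
  proof (induction n)
    case (Suc n)
    have "fps_exp (2 * of_nat n + 1) * (fps_exp 1 + fps_exp (- 1))
        = (fps_exp (2 * of_nat (Suc n)) + fps_exp (2 * of_nat n) :: rat fps)"
      by (simp add: distrib_left fps_exp_add_mult [symmetric] algebra_simps)
    then show ?case
      unfolding sum.lessThan_Suc distrib_right Suc.IH mult.assoc
      by (simp add: algebra_simps flip: fps_const_neg)
  qed simp
  from this[of N] have "E * (A * (fps_exp 1 + fps_exp (- 1))) = E * (1 + fps_exp (2 * of_nat N))"
    using assms by (simp add: A_def flip: fps_const_neg)
  moreover have "E * (fps_exp 1 + fps_exp (- 1)) = 2"
    unfolding E_def by (rule euler_number_egf)
  ultimately have "2 * A = E + E * fps_exp (2 * of_nat N)"
    by (metis (no_types, lifting) distrib_left mult.commute mult.left_commute mult_1)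
  then have "fact m * (2 * A) $ m = fact m * (E + E * fps_exp (2 * of_nat N)) $ m" by simp
  moreover have "fact m * (2 * A) $ m = 2 * (\<Sum>k<N. (- 1) ^ k * (2 * of_nat k + 1) ^ m)"
    by (simp add: A_def fps_sum_nth numeral_fps_const sum_distrib_left)
  moreover have "fact m * (E * fps_exp (2 * of_nat N)) $ m =
      (\<Sum>i=0..m. of_nat (m choose i) * of_int (euler_number i) * (2 * of_nat N) ^ (m - i))"
    unfolding fps_mult_nth sum_distrib_left
    by (intro sum.cong refl) (simp add: E_def binomial_fact field_simps)
  ultimately show ?thesis by (simp add: E_def distrib_left)
qed

section \<open>Alternating sums with inverse binomial coefficients\<close>
lemma inverse_binomial_Suc_Suc:
  assumes "i \<le> n"
  shows "1 / of_nat (Suc n choose Suc i) = (of_nat i + 1) / ((of_nat n + 1) * of_nat (n choose i) :: rat)"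
proof -
  have "rat_of_nat (Suc i * (Suc n choose Suc i)) = of_nat (Suc n * (n choose i))"
    by (simp only: Suc_times_binomial)
  moreover have "rat_of_nat (n choose i) \<noteq> 0" "rat_of_nat (Suc n choose Suc i) \<noteq> 0"
    "of_nat n + 1 \<noteq> (0::rat)"
    using assms by (simp_all add: add_nonneg_eq_0_iff del: binomial_Suc_Suc)
  ultimately show ?thesis
    by (simp add: divide_simps del: binomial_Suc_Suc) (simp add: algebra_simps del: binomial_Suc_Suc)
qed

lemma inverse_binomial_Suc:
  assumes "i \<le> n"
  shows "1 / of_nat (Suc n choose i) =
    (of_nat n + 1 - of_nat i) / ((of_nat n + 1) * of_nat (n choose i) :: rat)"
proof -
  have "rat_of_nat ((Suc n - i) * (Suc n choose i)) = of_nat (Suc n * (n choose i))"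
    using binomial_absorb_comp[of "Suc n" i] by simp
  then have "(of_nat n + 1 - of_nat i) * rat_of_nat (Suc n choose i) = (of_nat n + 1) * of_nat (n choose i)"
    unfolding of_nat_mult of_nat_diff[OF le_SucI[OF assms]] by (simp add: add.commute)
  moreover have "rat_of_nat (n choose i) \<noteq> 0" "rat_of_nat (Suc n choose i) \<noteq> 0"
    "of_nat n + 1 \<noteq> (0::rat)"
    using assms by (simp_all add: add_nonneg_eq_0_iff)
  ultimately show ?thesis
    by (simp add: divide_simps)
qed

text \<open>
  Each 1/C(n,i) is (n+1)/(n+2) times the sum of 1/C(n+1,i) and 1/C(n+1,i+1), so the alternating sum
  telescopes.
\<close>
lemma alternating_sum_inverse_binomial:
  "(\<Sum>i=0..n. (- 1) ^ i / of_nat (n choose i)) = (1 + (- 1) ^ n) * (of_nat n + 1) / (of_nat n + 2 :: rat)"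
proof -
  define g :: "nat \<Rightarrow> rat" where "g i = (- 1) ^ i / of_nat (Suc n choose i)" for i
  have nz: "of_nat n + 1 \<noteq> (0::rat)" "of_nat n + 2 \<noteq> (0::rat)"
    by (simp_all add: add_nonneg_eq_0_iff)
  have split: "(- 1) ^ i / of_nat (n choose i) = (of_nat n + 1) / (of_nat n + 2) * (g i - g (Suc i))"
    if "i \<le> n" for i
  proof -
    have "rat_of_nat (n choose i) \<noteq> 0" using that by simp
    have "g i - g (Suc i) = (- 1) ^ i * (1 / of_nat (Suc n choose i) + 1 / of_nat (Suc n choose Suc i))"
      by (simp add: g_def algebra_simps del: binomial_Suc_Suc)
    also have "\<dots> = (- 1) ^ i * ((of_nat n + 2) / ((of_nat n + 1) * of_nat (n choose i)))"
      unfolding inverse_binomial_Suc[OF that] inverse_binomial_Suc_Suc[OF that]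
        add_divide_distrib [symmetric] by simp
    finally show ?thesis using nz by simp
  qed
  have "(\<Sum>i=0..n. (- 1) ^ i / of_nat (n choose i)) = (of_nat n + 1) / (of_nat n + 2) * (\<Sum>i=0..n. g i - g (Suc i))"
    unfolding sum_distrib_left by (intro sum.cong refl split) simp
  also have "(\<Sum>i=0..n. g i - g (Suc i)) = g 0 - g (Suc n)"
    by (simp add: sum_telescope atLeast0AtMost)
  finally show ?thesis by (simp add: g_def mult.commute)
qed

text \<open>
  Passing from n to n+1 multiplies the summand by 1 - i/(n+1).  The factor i together with C(n,i) in
  the denominator turns the correction into the alternating sum of 1/C(n-1,i-1), which the previous
  lemma evaluates; the increment is (1 + 2(-1)^(n+1)) / (n+1)^2 for either parity of n.
\<close>
lemma alternating_sum_inverse_square_binomial: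
  "(\<Sum>i=1..n. (- 1) ^ i / (of_nat i ^ 2 * of_nat (n choose i))) =
   (\<Sum>j=1..n. (1 + 2 * (- 1) ^ j) / of_nat j ^ 2 :: rat)"
proof (induction n)
  case (Suc n)
  have "(\<Sum>i=1..n. (- 1) ^ i / (of_nat i ^ 2 * of_nat (Suc n choose i))) =
     (\<Sum>i=1..n. (- 1) ^ i / (of_nat i ^ 2 * of_nat (n choose i)))
     + (1 - (- 1) ^ n) / (of_nat n + 1 :: rat) ^ 2"
    (is "?L = ?R + _")
  proof (cases n)
    case (Suc m)
    have nz: "of_nat m + 1 \<noteq> (0::rat)" "of_nat m + 2 \<noteq> (0::rat)"
      by (simp_all add: add_nonneg_eq_0_iff)
    have split: "(- 1) ^ i / (of_nat i ^ 2 * of_nat (Suc n choose i)) =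
        ((- 1) ^ i / (of_nat i ^ 2 * of_nat (n choose i))
         + 1 / ((of_nat m + 1) * (of_nat m + 2)) * ((- 1) ^ (i - 1) / of_nat (m choose (i - 1))) :: rat)"
      if "i \<in> {1..n}" for i
    proof -
      have "i \<noteq> 0" and "i \<le> n" using that by auto
      then obtain k where i: "i = Suc k" by (meson not0_implies_Suc)
      with \<open>i \<le> n\<close> have km: "k \<le> m" using Suc by simp
      define K C where "K = (of_nat k :: rat)" and "C = (1 / of_nat (m choose k) :: rat)"
      have K: "K + 1 \<noteq> 0" by (simp add: K_def add_nonneg_eq_0_iff)
      have C1: "1 / of_nat (n choose i) = (K + 1) / (of_nat m + 1) * C"
        unfolding Suc i inverse_binomial_Suc_Suc[OF km] by (simp add: K_def C_def)
      have C2: "1 / of_nat (Suc n choose i) = (of_nat m + 1 - K) / (of_nat m + 2) * (1 / of_nat (n choose i))"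
        unfolding inverse_binomial_Suc[OF \<open>i \<le> n\<close>] by (simp add: Suc i K_def algebra_simps)
      have "(- 1) ^ i / (of_nat i ^ 2 * of_nat (Suc n choose i)) = (- 1) ^ i / (K + 1) ^ 2 * (1 / of_nat (Suc n choose i))"
        by (simp add: i K_def add.commute del: binomial_Suc_Suc)
      also have "\<dots> = - ((- 1) ^ k) / (K + 1) ^ 2 * ((of_nat m + 1 - K) / (of_nat m + 2) * ((K + 1) / (of_nat m + 1) * C))"
        by (simp only: C1 C2) (simp add: i)
      also have "\<dots> = - ((- 1) ^ k) / (K + 1) ^ 2 * ((K + 1) / (of_nat m + 1) * C)
          + 1 / ((of_nat m + 1) * (of_nat m + 2)) * ((- 1) ^ k * C)"
        using nz K by (simp add: divide_simps power2_eq_square) (simp add: algebra_simps)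
      also have "\<dots> = (- 1) ^ i / (K + 1) ^ 2 * (1 / of_nat (n choose i))
          + 1 / ((of_nat m + 1) * (of_nat m + 2)) * ((- 1) ^ k * C)"
        by (simp only: C1) (simp add: i)
      finally show ?thesis
        by (simp add: i K_def C_def add.commute del: binomial_Suc_Suc)
    qed
    have "?L = ?R + 1 / ((of_nat m + 1) * (of_nat m + 2))
        * (\<Sum>i=1..n. (- 1) ^ (i - 1) / of_nat (m choose (i - 1)) :: rat)"
      unfolding sum_distrib_left sum.distrib[symmetric] by (intro sum.cong refl split)
    also have "(\<Sum>i=1..n. (- 1) ^ (i - 1) / of_nat (m choose (i - 1)) :: rat)
        = (\<Sum>i=0..m. (- 1) ^ i / of_nat (m choose i))"
      unfolding Suc One_nat_def sum.shift_bounds_cl_Suc_ivl by simp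
    also have "\<dots> = (1 + (- 1) ^ m) * (of_nat m + 1) / (of_nat m + 2)"
      by (rule alternating_sum_inverse_binomial)
    also have "1 / ((of_nat m + 1) * (of_nat m + 2)) * ((1 + (- 1) ^ m) * (of_nat m + 1) / (of_nat m + 2))
        = (1 - (- 1) ^ n) / (of_nat n + 1 :: rat) ^ 2"
      using nz by (simp add: Suc power2_eq_square add.commute)
    finally show ?thesis .
  qed simp
  moreover have "(\<Sum>i=1..Suc n. (- 1) ^ i / (of_nat i ^ 2 * of_nat (Suc n choose i)))
     = ?L + (- 1) ^ Suc n / (of_nat n + 1 :: rat) ^ 2"
    by (simp add: add.commute)
  ultimately have "(\<Sum>i=1..Suc n. (- 1) ^ i / (of_nat i ^ 2 * of_nat (Suc n choose i))) =
      (\<Sum>j=1..n. (1 + 2 * (- 1) ^ j) / of_nat j ^ 2)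
      + (1 - (- 1) ^ n) / (of_nat n + 1 :: rat) ^ 2 + (- 1) ^ Suc n / (of_nat n + 1) ^ 2"
    by (simp only: Suc.IH)
  also have "\<dots> = (\<Sum>j=1..n. (1 + 2 * (- 1) ^ j) / of_nat j ^ 2) + (1 + 2 * (- 1) ^ Suc n) / (of_nat n + 1) ^ 2"
    by (simp add: diff_divide_distrib)
  also have "\<dots> = (\<Sum>j=1..Suc n. (1 + 2 * (- 1) ^ j) / of_nat j ^ 2)"
    by (simp add: add.commute)
  finally show ?case .
qed simp

section \<open>Congruences between rational numbers\<close>
lemma denom_prime_to_iff:
  "denom_prime_to p r \<longleftrightarrow> (\<exists>a b. b \<noteq> 0 \<and> coprime b (int p) \<and> r = of_int a / of_int b)"
proof
  assume "denom_prime_to p r"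
  moreover obtain a b where ab: "quotient_of r = (a, b)" by fastforce
  ultimately have "coprime b (int p)" by (simp add: denom_prime_to_def)
  then show "\<exists>a b. b \<noteq> 0 \<and> coprime b (int p) \<and> r = of_int a / of_int b"
    using quotient_of_div[OF ab] quotient_of_denom_pos[OF ab] by (metis less_imp_neq)
next
  assume "\<exists>a b. b \<noteq> 0 \<and> coprime b (int p) \<and> r = of_int a / of_int b"
  then obtain a b where b: "b \<noteq> 0" "coprime b (int p)" and r: "r = of_int a / of_int b" by blast
  obtain c d where cd: "quotient_of r = (c, d)" by fastforce
  have d: "d > 0" "coprime c d" and r': "r = of_int c / of_int d"
    using quotient_of_denom_pos[OF cd] quotient_of_coprime[OF cd] quotient_of_div[OF cd] by auto
  have "(of_int (a * d) :: rat) = of_int (c * b)"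
    using r r' b(1) d(1) by (simp add: field_simps)
  then have "a * d = c * b" by (simp only: of_int_eq_iff)
  then have "d dvd c * b" by (metis dvd_triv_right)
  then have "d dvd b" using d(2) by (metis coprime_commute coprime_dvd_mult_right_iff)
  then show "denom_prime_to p r"
    using b(2) cd unfolding denom_prime_to_def by (auto intro: coprime_imp_coprime dvd_trans)
qed

text \<open>
  All congruences take place in the ring of rational numbers with denominators prime to p; its
  units include every integer strictly between 0 and p.
\<close>
locale prime_gt_3 =
  fixes p :: nat
  assumes prime_p: "prime p" and p_gt_3: "p > 3"
begin

abbreviation p_integral :: "rat \<Rightarrow> bool" where
  "p_integral \<equiv> denom_prime_to p"

abbreviation cong_mod_power :: "rat \<Rightarrow> nat \<Rightarrow> rat \<Rightarrow> bool" ("(_ \<approx>[_] _)" [51, 0, 51] 50) where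
  "a \<approx>[m] b \<equiv> rat_cong p m a b"

abbreviation P :: rat where "P \<equiv> of_nat p"

definition h :: nat where "h = (p - 1) div 2"

abbreviation \<epsilon> :: rat where "\<epsilon> \<equiv> (- 1) ^ h"

lemma p_odd [simp]: "odd p"
  using prime_p p_gt_3 by (simp add: prime_odd_nat)

lemma p_eq: "2 * h + 1 = p"
  using p_odd by (auto simp: h_def elim: oddE)

lemma p_pred_eq: "p - 1 = 2 * h"
  using p_eq by linarith

lemma h_gt_1: "h > 1"
  using p_gt_3 p_eq by linarith

lemma P_eq: "P = 2 * of_nat h + 1"
  using arg_cong[OF p_eq, of "of_nat :: nat \<Rightarrow> rat"] by simp

lemma P_nonzero: "P \<noteq> 0"
  using p_gt_3 by simp

lemma sign_square: "\<epsilon> * \<epsilon> = 1"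
  by (simp flip: power_add mult_2)

lemma coprime_lt: "0 < n \<Longrightarrow> n < p \<Longrightarrow> coprime n p"
  using prime_p by (metis coprime_commute nat_dvd_not_less prime_imp_coprime)

lemma coprime_numerals [simp]: "coprime 2 p" "coprime 3 p" "coprime (2 ^ k) p"
  using coprime_lt[of 2] coprime_lt[of 3] p_gt_3 by auto

lemma coprime_4 [simp]: "coprime 4 p"
proof -
  have "coprime (2 ^ 2) p" by (rule coprime_numerals)
  moreover have "(2 :: nat) ^ 2 = 4" by simp
  ultimately show ?thesis by (simp only:)
qed

lemma p_integral_of_int [simp]: "p_integral (of_int a)"
  unfolding denom_prime_to_iff by (intro exI[of _ a] exI[of _ 1]) simp

lemma p_integral_of_nat [simp]: "p_integral (of_nat a)"
  using p_integral_of_int[of "int a"] by simp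

lemma p_integral_numeral [simp]: "p_integral 0" "p_integral 1" "p_integral (numeral w)"
  using p_integral_of_nat[of 0] p_integral_of_nat[of 1] p_integral_of_nat[of "numeral w"] by simp_all

lemma p_integral_add [simp]:
  assumes "p_integral a" "p_integral b"
  shows "p_integral (a + b)"
proof -
  obtain x y u v where *: "y \<noteq> 0" "coprime y (int p)" "a = of_int x / of_int y"
    "v \<noteq> 0" "coprime v (int p)" "b = of_int u / of_int v"
    using assms unfolding denom_prime_to_iff by blast
  then show ?thesis
    unfolding denom_prime_to_iff
    by (intro exI[of _ "x * v + u * y"] exI[of _ "y * v"]) (simp add: field_simps)
qed

lemma p_integral_mult [simp]:
  assumes "p_integral a" "p_integral b"
  shows "p_integral (a * b)"
proof -
  obtain x y u v where *: "y \<noteq> 0" "coprime y (int p)" "a = of_int x / of_int y"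
    "v \<noteq> 0" "coprime v (int p)" "b = of_int u / of_int v"
    using assms unfolding denom_prime_to_iff by blast
  then show ?thesis
    unfolding denom_prime_to_iff
    by (intro exI[of _ "x * u"] exI[of _ "y * v"]) simp
qed

lemma p_integral_minus [simp]: "p_integral a \<Longrightarrow> p_integral (- a)"
  using p_integral_mult[OF p_integral_of_int[of "- 1"], of a] by simp

lemma p_integral_diff [simp]: "p_integral a \<Longrightarrow> p_integral b \<Longrightarrow> p_integral (a - b)"
  using p_integral_add[of a "- b"] by simp

lemma p_integral_power [simp]: "p_integral a \<Longrightarrow> p_integral (a ^ n)"
  by (induction n) simp_all

lemma p_integral_sum [simp]: "(\<And>i. i \<in> A \<Longrightarrow> p_integral (f i)) \<Longrightarrow> p_integral (sum f A)"
  by (induction A rule: infinite_finite_induct) simp_all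

lemma p_integral_divide:
  assumes "p_integral a" "coprime n p"
  shows "p_integral (a / of_nat n)"
proof (cases "n = 0")
  case False
  then have "p_integral (1 / of_nat n)"
    unfolding denom_prime_to_iff using assms(2)
    by (intro exI[of _ 1] exI[of _ "int n"]) simp
  with assms(1) have "p_integral (a * (1 / of_nat n))" by (rule p_integral_mult)
  then show ?thesis by simp
qed simp

lemma p_integral_halve [simp]: "p_integral a \<Longrightarrow> p_integral (a / 2)"
  using p_integral_divide[of a 2] by simp

lemma p_integral_quarter [simp]: "p_integral a \<Longrightarrow> p_integral (a / 4)"
  using p_integral_divide[of a 4] by simp

lemma rat_cong_intro:
  assumes "p_integral b" "p_integral c" "a = b + P ^ m * c"
  shows "a \<approx>[m] b"
  unfolding rat_cong_def using assms P_nonzero by simp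

lemma rat_congE:
  assumes "a \<approx>[m] b"
  obtains c where "p_integral c" "a = b + P ^ m * c"
proof (rule that)
  show "p_integral ((a - b) / P ^ m)" using assms by (simp add: rat_cong_def)
  show "a = b + P ^ m * ((a - b) / P ^ m)" using P_nonzero by simp
qed

lemma rat_cong_integral: "a \<approx>[m] b \<Longrightarrow> p_integral a" "a \<approx>[m] b \<Longrightarrow> p_integral b"
  by (simp_all add: rat_cong_def)

lemma rat_cong_refl: "p_integral a \<Longrightarrow> a \<approx>[m] a"
  by (simp add: rat_cong_def)

lemma rat_cong_sym: "a \<approx>[m] b \<Longrightarrow> b \<approx>[m] a"
proof -
  assume *: "a \<approx>[m] b"
  then obtain c where "p_integral c" "a = b + P ^ m * c" by (rule rat_congE)
  with * show ?thesis by (intro rat_cong_intro[of a "- c"]) (simp_all add: rat_cong_integral)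
qed

lemma rat_cong_trans [trans]:
  assumes "a \<approx>[m] b" "b \<approx>[m] c"
  shows "a \<approx>[m] c"
proof -
  obtain x y where "p_integral x" "a = b + P ^ m * x" "p_integral y" "b = c + P ^ m * y"
    using assms by (meson rat_congE)
  then show ?thesis
    using rat_cong_integral(2)[OF assms(2)]
    by (intro rat_cong_intro[of c "x + y"]) (simp_all add: algebra_simps)
qed

lemma rat_cong_add:
  assumes "a \<approx>[m] b" "c \<approx>[m] d"
  shows "a + c \<approx>[m] b + d"
proof -
  obtain x y where "p_integral x" "a = b + P ^ m * x" "p_integral y" "c = d + P ^ m * y"
    using assms by (meson rat_congE)
  then show ?thesis
    using assms[THEN rat_cong_integral(2)]
    by (intro rat_cong_intro[of "b + d" "x + y"]) (simp_all add: algebra_simps)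
qed

lemma rat_cong_mult:
  assumes "a \<approx>[m] b" "c \<approx>[m] d"
  shows "a * c \<approx>[m] b * d"
proof -
  obtain x y where "p_integral x" "a = b + P ^ m * x" "p_integral y" "c = d + P ^ m * y"
    using assms by (meson rat_congE)
  then show ?thesis
    using assms[THEN rat_cong_integral(2)]
    by (intro rat_cong_intro[of "b * d" "x * d + b * y + P ^ m * x * y"]) (simp_all add: algebra_simps)
qed

lemma rat_cong_minus: "a \<approx>[m] b \<Longrightarrow> - a \<approx>[m] - b"
  using rat_cong_mult[OF rat_cong_refl[OF p_integral_of_int[of "- 1"]], of m a b] by simp

lemma rat_cong_diff: "a \<approx>[m] b \<Longrightarrow> c \<approx>[m] d \<Longrightarrow> a - c \<approx>[m] b - d"
  using rat_cong_add[OF _ rat_cong_minus, of m a b c d] by simp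

lemma rat_cong_mult_left: "p_integral c \<Longrightarrow> a \<approx>[m] b \<Longrightarrow> c * a \<approx>[m] c * b"
  by (intro rat_cong_mult rat_cong_refl)

lemma rat_cong_power: "a \<approx>[m] b \<Longrightarrow> a ^ n \<approx>[m] b ^ n"
  by (induction n) (simp_all add: rat_cong_refl rat_cong_mult)

lemma rat_cong_sum: "(\<And>i. i \<in> A \<Longrightarrow> f i \<approx>[m] g i) \<Longrightarrow> sum f A \<approx>[m] sum g A"
  by (induction A rule: infinite_finite_induct) (simp_all add: rat_cong_refl rat_cong_add)

lemma rat_cong_lower:
  assumes "a \<approx>[m] b" "k \<le> m"
  shows "a \<approx>[k] b"
proof -
  obtain c where "p_integral c" "a = b + P ^ m * c" using assms(1) by (rule rat_congE)
  then show ?thesis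
    using rat_cong_integral(2)[OF assms(1)] assms(2)
    by (intro rat_cong_intro[of b "P ^ (m - k) * c"]) (simp_all add: power_add [symmetric] mult.assoc [symmetric])
qed

lemma rat_cong_lift:
  assumes "a \<approx>[m] b"
  shows "P ^ k * a \<approx>[k + m] P ^ k * b"
proof -
  obtain c where "p_integral c" "a = b + P ^ m * c" using assms by (rule rat_congE)
  then show ?thesis
    using rat_cong_integral(2)[OF assms]
    by (intro rat_cong_intro[of "P ^ k * b" c]) (simp_all add: algebra_simps power_add)
qed

lemma rat_cong_divide:
  assumes "a \<approx>[m] b" "coprime n p"
  shows "a / of_nat n \<approx>[m] b / of_nat n"
  using rat_cong_mult_left[OF p_integral_divide[OF p_integral_numeral(2) assms(2)] assms(1)] by simp

lemma rat_cong_cancel: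
  assumes "of_nat n * a \<approx>[m] of_nat n * b" "coprime n p"
  shows "a \<approx>[m] b"
proof -
  have "n \<noteq> 0" using assms(2) p_gt_3 by (intro notI) simp
  then show ?thesis using rat_cong_divide[OF assms] by simp
qed

lemma rat_cong_inverse:
  assumes "a \<approx>[m] b" "p_integral (1 / a)" "p_integral (1 / b)" "a \<noteq> 0" "b \<noteq> 0"
  shows "1 / a \<approx>[m] 1 / b"
proof -
  have "1 / a * (1 / b) * b \<approx>[m] 1 / a * (1 / b) * a"
    using assms(2,3) rat_cong_sym[OF assms(1)] by (intro rat_cong_mult_left p_integral_mult)
  then show ?thesis using assms(4,5) by simp
qed

lemma rat_cong_of_nat: "[a = b] (mod p) \<Longrightarrow> of_nat a \<approx>[1] of_nat b"
proof -
  assume "[a = b] (mod p)"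
  then obtain c where "int a = int b + int p * c"
    by (metis cong_int_iff cong_iff_lin cong_sym)
  then have "(of_nat a :: rat) = of_nat b + P * of_int c"
    by (metis of_int_add of_int_mult of_int_of_nat_eq)
  then show ?thesis by (intro rat_cong_intro[of _ "of_int c"]) simp_all
qed

lemma fermat:
  assumes "coprime n p"
  shows "of_nat n ^ (p - 1) \<approx>[1] 1"
proof -
  have "\<not> p dvd n"
  proof
    assume "p dvd n"
    then have "is_unit p" using coprime_common_divisor[of n p p] assms by simp
    then show False using p_gt_3 by simp
  qed
  then have "[n ^ (p - 1) = 1] (mod p)" using prime_p by (rule fermat_theorem[rotated])
  from rat_cong_of_nat[OF this] show ?thesis by simp
qed

lemma P_cong_0: "P \<approx>[1] 0"
  by (intro rat_cong_intro[of 0 1]) simp_all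

lemma inverse_square_reflect:
  assumes "0 < j" "j < p"
  shows "1 / of_nat (p - j) ^ 2 \<approx>[1] 1 / of_nat j ^ 2"
proof -
  have "of_nat (p - j) ^ 2 \<approx>[1] (of_nat j ^ 2 :: rat)"
  proof (rule rat_cong_intro)
    have "rat_of_nat (p - j) = P - of_nat j" using assms by (simp add: of_nat_diff)
    then show "of_nat (p - j) ^ 2 = of_nat j ^ 2 + P ^ 1 * (P - 2 * of_nat j)"
      by (simp only:) (simp add: power2_eq_square algebra_simps)
  qed simp_all
  moreover have "coprime (j ^ 2) p" "coprime ((p - j) ^ 2) p"
    using coprime_lt[of j] coprime_lt[of "p - j"] assms by simp_all
  then have "p_integral (1 / of_nat (j ^ 2))" "p_integral (1 / of_nat ((p - j) ^ 2))"
    by (auto intro!: p_integral_divide simp del: of_nat_power coprime_power_left_iff)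
  ultimately show ?thesis
    using assms by (intro rat_cong_inverse) simp_all
qed

section \<open>The sum of the inverse squares vanishes modulo p\<close>
lemma sum_reflect_pairs:
  fixes f :: "nat \<Rightarrow> 'b :: comm_monoid_add"
  shows "(\<Sum>j=1..p - 1. f j) = (\<Sum>j=1..h. f j) + (\<Sum>j=1..h. f (p - j))"
proof -
  have "(\<Sum>j=1..2 * n. f j) = (\<Sum>j=1..n. f j) + (\<Sum>j=1..n. f (2 * n + 1 - j))" for n
  proof -
    have "(\<Sum>j=1..2 * n. f j) = (\<Sum>j=1..n. f j) + (\<Sum>j=n + 1..n + n. f j)"
      unfolding mult_2 by (rule sum.ub_add_nat) simp
    also have "(\<Sum>j=n + 1..n + n. f j) = (\<Sum>j=1..n. f (2 * n + 1 - j))"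
      by (rule sum.reindex_bij_witness[of _ "\<lambda>j. 2 * n + 1 - j" "\<lambda>j. 2 * n + 1 - j"]) auto
    finally show ?thesis .
  qed
  from this[of h] show ?thesis
    by (simp only: p_eq p_pred_eq)
qed

lemma sum_even_odd_pairs:
  fixes f :: "nat \<Rightarrow> 'b :: comm_monoid_add"
  shows "(\<Sum>j=1..p - 1. f j) = (\<Sum>i=1..h. f (2 * i)) + (\<Sum>i=1..h. f (p - 2 * i))"
proof -
  have "(\<Sum>j=1..2 * n. f j) = (\<Sum>i=1..n. f (2 * i)) + (\<Sum>i=1..n. f (2 * n + 1 - 2 * i))" for n
  proof -
    have "(\<Sum>j=1..2 * n. f j) = (\<Sum>i=1..n. f (2 * i)) + (\<Sum>i=1..n. f (2 * i - 1))"
      by (induction n) (simp_all add: add_ac)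
    also have "(\<Sum>i=1..n. f (2 * i - 1)) = (\<Sum>i=1..n. f (2 * (n + 1 - i) - 1))"
      by (rule sum.atLeastAtMost_rev [THEN trans]) simp
    also have "\<dots> = (\<Sum>i=1..n. f (2 * n + 1 - 2 * i))"
      by (intro sum.cong refl arg_cong[of _ _ f]) auto
    finally show ?thesis .
  qed
  from this[of h] show ?thesis
    by (simp only: p_eq p_pred_eq)
qed

definition H2 :: rat where "H2 = (\<Sum>j=1..h. 1 / of_nat j ^ 2)"

lemma sum_inverse_squares: "(\<Sum>j=1..p - 1. 1 / of_nat j ^ 2) \<approx>[1] 2 * H2"
proof -
  have "(\<Sum>j=1..h. 1 / of_nat (p - j) ^ 2) \<approx>[1] H2"
    unfolding H2_def
  proof (intro rat_cong_sum inverse_square_reflect)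
    fix j assume "j \<in> {1..h}"
    then show "0 < j" "j < p" using p_eq unfolding atLeastAtMost_iff by linarith+
  qed
  from rat_cong_add[OF rat_cong_refl[OF rat_cong_integral(2)[OF this]] this] show ?thesis
    unfolding sum_reflect_pairs mult_2 H2_def .
qed

text \<open>
  Reflecting j to p - j shows that the sum of 1/j^2 over 0 < j < p is 2 H2 modulo p.  Splitting the same sum
  into even indices 2i and odd indices p - 2i shows that it is H2/2.  Hence 3 H2 \<equiv> 0.
\<close>
lemma H2_cong_0: "H2 \<approx>[1] 0"
proof -
  have lt: "0 < 2 * j \<and> 2 * j < p" "0 < j \<and> j < p" if "j \<in> {1..h}" for j
    using that p_eq unfolding atLeastAtMost_iff by linarith+
  have "(\<Sum>j=1..p - 1. 1 / of_nat j ^ 2) \<approx>[1] H2 / 4 + H2 / 4"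
  proof -
    have quarter: "(\<Sum>i=1..h. 1 / of_nat (2 * i) ^ 2) = H2 / 4"
      by (simp add: H2_def sum_divide_distrib power_mult_distrib mult.commute)
    have reflect: "(\<Sum>i=1..h. 1 / of_nat (p - 2 * i) ^ 2) \<approx>[1] (\<Sum>i=1..h. 1 / of_nat (2 * i) ^ 2)"
      using lt by (intro rat_cong_sum inverse_square_reflect) auto
    show ?thesis
      using rat_cong_add[OF rat_cong_refl[OF rat_cong_integral(2)[OF reflect]] reflect]
      unfolding quarter sum_even_odd_pairs .
  qed
  then have "2 * H2 \<approx>[1] H2 / 2"
    using rat_cong_trans[OF rat_cong_sym[OF sum_inverse_squares]] by simp
  from rat_cong_diff[OF this rat_cong_refl[OF rat_cong_integral(2)[OF this]]]
  have "2 * H2 - H2 / 2 \<approx>[1] 0" by simp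
  then have "2 * (2 * H2 - H2 / 2) \<approx>[1] 2 * 0"
    by (intro rat_cong_mult_left) simp_all
  moreover have "2 * (2 * H2 - H2 / 2) = of_nat 3 * H2" by simp
  ultimately have "of_nat 3 * H2 \<approx>[1] of_nat 3 * 0" by (simp only: mult_zero_right)
  then show ?thesis by (rule rat_cong_cancel) simp
qed

section \<open>The congruences of Morley and Wolstenholme\<close>

text \<open>
  The coefficients are the elementary symmetric functions of the f(j), the second one written with
  power sums because the sum of the squares is the quantity that vanishes modulo p below.
\<close>
lemma prod_one_plus_expansion:
  assumes "finite A" "p_integral x" "\<And>j. j \<in> A \<Longrightarrow> p_integral (f j)"
  obtains c where "p_integral c"
    "(\<Prod>j\<in>A. 1 + x * f j) = 1 + x * sum f A + x ^ 2 * ((sum f A ^ 2 - (\<Sum>j\<in>A. f j ^ 2)) / 2) + x ^ 3 * c"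
proof -
  have "\<exists>c. p_integral c \<and>
    (\<Prod>j\<in>A. 1 + x * f j) = 1 + x * sum f A + x ^ 2 * ((sum f A ^ 2 - (\<Sum>j\<in>A. f j ^ 2)) / 2) + x ^ 3 * c"
    using assms(1,3)
  proof (induction A)
    case empty
    show ?case by (intro exI[of _ 0]) simp
  next
    case (insert a A)
    then obtain c where c: "p_integral c" "(\<Prod>j\<in>A. 1 + x * f j)
        = 1 + x * sum f A + x ^ 2 * ((sum f A ^ 2 - (\<Sum>j\<in>A. f j ^ 2)) / 2) + x ^ 3 * c" by auto
    define s s\<^sub>2 where "s = sum f A" and "s\<^sub>2 = (\<Sum>j\<in>A. f j ^ 2)"
    have int: "p_integral s" "p_integral s\<^sub>2" "p_integral (f a)"
      using insert.prems by (simp_all add: s_def s\<^sub>2_def)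
    show ?case
    proof (intro exI conjI)
      show "p_integral (c + f a * ((s ^ 2 - s\<^sub>2) / 2) + x * f a * c)"
        using int c(1) assms(2) by simp
      show "(\<Prod>j\<in>insert a A. 1 + x * f j) = 1 + x * sum f (insert a A)
          + x ^ 2 * ((sum f (insert a A) ^ 2 - (\<Sum>j\<in>insert a A. f j ^ 2)) / 2)
          + x ^ 3 * (c + f a * ((s ^ 2 - s\<^sub>2) / 2) + x * f a * c)"
        using insert.hyps unfolding prod.insert[OF insert.hyps] sum.insert[OF insert.hyps] c(2)
          s_def [symmetric] s\<^sub>2_def [symmetric]
        by (simp add: field_simps power2_eq_square power3_eq_cube)
    qed
  qed
  then show thesis using that by blast
qed

lemma p_integral_inverse: "j \<in> {1..h} \<Longrightarrow> p_integral (1 / of_nat j)"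
  using coprime_lt[of j] p_eq by (intro p_integral_divide) simp_all

lemma binomial_pred_prime:
  "of_nat (p - 1 choose k) = (- 1) ^ k * (\<Prod>j=1..k. 1 + P * (- 1 / of_nat j))"
proof -
  have "of_nat (p - 1 choose k) = ((P - 1) gchoose k)"
    using p_gt_3 by (simp add: binomial_gbinomial of_nat_diff)
  also have "\<dots> = (\<Prod>i=0..<k. P - 1 - of_nat i) / fact k"
    by (rule gbinomial_prod_rev)
  also have "(\<Prod>i=0..<k. P - 1 - of_nat i) = (\<Prod>j=1..k. P - of_nat j)"
    by (rule prod.reindex_bij_witness[of _ "\<lambda>j. j - 1" Suc]) auto
  also have "fact k = (\<Prod>j=1..k. of_nat j :: rat)"
    by (simp add: fact_prod)
  also have "(\<Prod>j=1..k. P - of_nat j) / (\<Prod>j=1..k. of_nat j) = (\<Prod>j=1..k. - 1 * (1 + P * (- 1 / of_nat j)))"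
    unfolding prod_dividef [symmetric] by (intro prod.cong refl) (simp add: field_simps)
  finally show ?thesis by (simp only: prod.distrib) simp
qed

lemma binomial_pred_cong:
  assumes "k < p"
  shows "of_nat (p - 1 choose k) \<approx>[1] (- 1) ^ k"
proof -
  have int: "p_integral (- 1 / of_nat j)" if "j \<in> {1..k}" for j
    using that assms coprime_lt[of j] by (intro p_integral_divide) auto
  obtain c where c: "p_integral c" "(\<Prod>j=1..k. 1 + P * (- 1 / of_nat j)) = 1 + P * sum (\<lambda>j. - 1 / of_nat j) {1..k}
      + P ^ 2 * ((sum (\<lambda>j. - 1 / of_nat j) {1..k} ^ 2 - (\<Sum>j=1..k. (- 1 / of_nat j) ^ 2)) / 2) + P ^ 3 * c"
    using prod_one_plus_expansion[of "{1..k}" P "\<lambda>j. - 1 / of_nat j"] int by auto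
  define s t where "s = sum (\<lambda>j. - 1 / rat_of_nat j) {1..k}" and
    "t = (\<Sum>j=1..k. (- 1 / rat_of_nat j) ^ 2)"
  have "p_integral s" "p_integral t"
    unfolding s_def t_def by (intro p_integral_sum p_integral_power int; assumption)+
  then show ?thesis
    using c(1) unfolding binomial_pred_prime c(2) s_def [symmetric] t_def [symmetric]
    by (intro rat_cong_intro[of _ "(- 1) ^ k * (s + P * ((s ^ 2 - t) / 2) + P ^ 2 * c)"])
       (simp_all add: algebra_simps power2_eq_square power3_eq_cube)
qed

abbreviation u :: rat where "u \<equiv> 2 ^ (p - 1)"

lemma u_cong_1: "u \<approx>[1] 1"
  using fermat[of 2] by simp

text \<open>
  The product of the 1 - x/j over 0 < j \<le> h, taken at x = p and x = p/2, gives A = \<open>\<epsilon>\<close> C(p-1,h) and B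
  with A = 2^(p-1) B.  As the sum of the 1/j^2 vanishes modulo p, the product agrees with
  exp(-xH) modulo p^3, where H is the sum of the 1/j; therefore A \<equiv> B^2.  Since B is a unit, this
  forces B \<equiv> 2^(p-1) and A \<equiv> 4^(p-1).
\<close>
lemma morley: "of_nat (p - 1 choose h) \<approx>[3] \<epsilon> * u ^ 2"
proof -
  define H where "H = (\<Sum>j=1..h. 1 / rat_of_nat j)"
  have H: "p_integral H" unfolding H_def by (intro p_integral_sum p_integral_inverse)
  define A B where "A = (\<Prod>j=1..h. 1 + P * (- 1 / of_nat j))"
    and "B = (\<Prod>j=1..h. 1 + P / 2 * (- 1 / of_nat j))"
  have sums: "(\<Sum>j=1..h. - 1 / rat_of_nat j) = - H" "(\<Sum>j=1..h. (- 1 / rat_of_nat j) ^ 2) = H2"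
    by (simp_all add: H_def H2_def sum_negf power_divide)
  have int: "p_integral (- 1 / of_nat j)" if "j \<in> {1..h}" for j
    using p_integral_minus[OF p_integral_inverse[OF that]] by simp
  obtain k where k: "p_integral k" "H2 = P * k"
    using H2_cong_0 by (auto elim: rat_congE)
  obtain a where a: "p_integral a"
    "A = 1 - P * H + P ^ 2 * ((H ^ 2 - H2) / 2) + P ^ 3 * a"
    using prod_one_plus_expansion[of "{1..h}" P "\<lambda>j. - 1 / of_nat j"] int
    unfolding sums A_def by auto
  obtain b where b: "p_integral b"
    "B = 1 - P / 2 * H + (P / 2) ^ 2 * ((H ^ 2 - H2) / 2) + (P / 2) ^ 3 * b"
    using prod_one_plus_expansion[of "{1..h}" "P / 2" "\<lambda>j. - 1 / of_nat j"] int
    unfolding sums B_def by auto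
  \<comment> \<open>The truncation of exp(-pH/2); the truncation C of exp(pH/2) is its inverse modulo p^3.\<close>
  define B' where "B' = 1 - P * H / 2 + P ^ 2 * H ^ 2 / 8"
  have int8: "p_integral (x / 4)" "p_integral (x / 8)" "p_integral (x / 16)" "p_integral (x / 32)"
    "p_integral (x / 64)" if "p_integral x" for x
    using p_integral_divide[OF that coprime_numerals(3)[of 2]] p_integral_divide[OF that coprime_numerals(3)[of 3]]
      p_integral_divide[OF that coprime_numerals(3)[of 4]] p_integral_divide[OF that coprime_numerals(3)[of 5]]
      p_integral_divide[OF that coprime_numerals(3)[of 6]]
    by simp_all
  have B': "p_integral B'" using H by (simp add: B'_def int8)
  have BB': "B \<approx>[3] B'"
    using H b(1) k(1)
    by (intro rat_cong_intro[OF B', of "- k / 8 + b / 8"])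
       (simp_all add: int8 b(2) k(2) B'_def power2_eq_square power3_eq_cube field_simps)
  have AB': "A \<approx>[3] B' * B'"
  proof (rule rat_cong_intro)
    show "p_integral (B' * B')" using B' by simp
    show "p_integral (a - k / 2 + H ^ 3 / 8 - P * H ^ 4 / 64)" using H a(1) k(1) by (simp add: int8)
    show "A = B' * B' + P ^ 3 * (a - k / 2 + H ^ 3 / 8 - P * H ^ 4 / 64)"
      by (simp add: a(2) k(2) B'_def power2_eq_square power3_eq_cube power4_eq_xxxx field_simps)
  qed
  have uB: "A = u * B"
  proof -
    have "u * B * (\<Prod>j=1..h. of_nat j) = (\<Prod>j=1..h. (- 1) * (2 * (P - 2 * of_nat j)))"
    proof -
      have "u = (\<Prod>j=1..h. 4)"
        unfolding p_pred_eq power_mult by simp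
      then have "u * B * (\<Prod>j=1..h. of_nat j) = (\<Prod>j=1..h. 4 * (1 + P / 2 * (- 1 / of_nat j)) * of_nat j)"
        unfolding B_def by (simp only: prod.distrib)
      also have "\<dots> = (\<Prod>j=1..h. (- 1) * (2 * (P - 2 * of_nat j)))"
        by (intro prod.cong refl) (simp add: field_simps)
      finally show ?thesis .
    qed
    also have "\<dots> = (\<Prod>j=1..h. - 1) * (2 ^ h * (\<Prod>j=1..h. P - 2 * of_nat j))"
      unfolding prod.distrib by simp
    also have "\<dots> = (\<Prod>j=1..h. - 1) * (\<Prod>j=1..h. P - of_nat j)"
      unfolding P_eq by (simp only: prod_odd_numbers)
    also have "\<dots> = (\<Prod>j=1..h. (1 + P * (- 1 / of_nat j)) * of_nat j)"
      unfolding prod.distrib [symmetric] by (intro prod.cong refl) (simp add: field_simps)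
    also have "\<dots> = A * (\<Prod>j=1..h. of_nat j)"
      unfolding A_def by (simp only: prod.distrib)
    finally show ?thesis by simp
  qed
  have u: "p_integral u" by simp
  define C where "C = 1 + P * H / 2 + P ^ 2 * H ^ 2 / 8"
  have C: "p_integral C" using H by (simp add: C_def int8)
  have B'C: "B' * C \<approx>[3] 1"
    using H
    by (intro rat_cong_intro[of _ "P * H ^ 4 / 64"])
       (simp_all add: int8 C_def B'_def power2_eq_square power3_eq_cube power4_eq_xxxx field_simps)
  have "u * (B' * C) \<approx>[3] u * 1"
    by (intro rat_cong_mult_left B'C) simp
  then have "u * 1 \<approx>[3] u * (B' * C)" by (rule rat_cong_sym)
  also have "u * (B' * C) \<approx>[3] u * (B * C)"
    using u C BB' by (intro rat_cong_mult rat_cong_refl) (auto intro: rat_cong_sym)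
  also have "u * (B * C) = A * C" by (simp add: uB)
  also have "A * C \<approx>[3] (B' * B') * C"
    using AB' C by (intro rat_cong_mult rat_cong_refl)
  also have "(B' * B') * C = B' * (B' * C)" by simp
  also have "\<dots> \<approx>[3] B' * 1" using B' by (intro rat_cong_mult_left B'C)
  finally have uB': "u \<approx>[3] B'" by simp
  have "A \<approx>[3] u * u"
    by (rule rat_cong_trans[OF AB']) (intro rat_cong_mult rat_cong_sym[OF uB'])
  then have "\<epsilon> * A \<approx>[3] \<epsilon> * (u * u)"
    by (rule rat_cong_mult_left[rotated]) simp
  then show ?thesis
    by (simp only: binomial_pred_prime A_def power2_eq_square)
qed

text \<open>
  C(2p,p) is the sum of the C(p,k)^2.  Apart from the two outer terms these are p^2/k^2 times a square
  that is 1 modulo p, and the sum of the 1/k^2 vanishes modulo p.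
\<close>
lemma wolstenholme: "of_nat (2 * p choose p) \<approx>[3] 2"
proof -
  have "(\<Sum>k=1..p - 1. (1 / of_nat k * of_nat (p - 1 choose (k - 1))) ^ 2) \<approx>[1]
      (\<Sum>k=1..p - 1. 1 / of_nat k ^ 2)"
  proof (rule rat_cong_sum)
    fix k assume k: "k \<in> {1..p - 1}"
    have "p_integral (1 / of_nat k)"
      using k coprime_lt[of k] p_gt_3 by (intro p_integral_divide) auto
    then have "(1 / of_nat k * of_nat (p - 1 choose (k - 1))) ^ 2 \<approx>[1] (1 / of_nat k * (- 1) ^ (k - 1)) ^ 2"
      using k by (intro rat_cong_power rat_cong_mult_left binomial_pred_cong) auto
    also have "(1 / of_nat k * (- 1) ^ (k - 1)) ^ 2 = (1 / of_nat k ^ 2 :: rat)"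
      unfolding power_mult_distrib power2_eq_square minus_one_mult_self by simp
    finally show "(1 / of_nat k * of_nat (p - 1 choose (k - 1))) ^ 2 \<approx>[1] 1 / of_nat k ^ 2" .
  qed
  also have "\<dots> \<approx>[1] 2 * H2" by (rule sum_inverse_squares)
  also have "\<dots> \<approx>[1] 2 * 0" by (intro rat_cong_mult_left H2_cong_0) simp
  finally have "P ^ 2 * (\<Sum>k=1..p - 1. (1 / of_nat k * of_nat (p - 1 choose (k - 1))) ^ 2) \<approx>[2 + 1] P ^ 2 * (2 * 0)"
    by (rule rat_cong_lift)
  moreover have "P ^ 2 * (\<Sum>k=1..p - 1. (1 / of_nat k * of_nat (p - 1 choose (k - 1))) ^ 2)
      = (\<Sum>k=1..p - 1. of_nat (p choose k) ^ 2)"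
    unfolding sum_distrib_left
  proof (intro sum.cong refl)
    fix k assume "k \<in> {1..p - 1}"
    then have k: "k \<noteq> 0" by auto
    have "rat_of_nat (k * (p choose k)) = of_nat (p * (p - 1 choose (k - 1)))"
      using k times_binomial_minus1_eq[of k p] by simp
    then have "rat_of_nat (p choose k) = P * (1 / of_nat k * of_nat (p - 1 choose (k - 1)))"
      using k by (simp add: field_simps)
    then show "P ^ 2 * (1 / of_nat k * of_nat (p - 1 choose (k - 1))) ^ 2 = of_nat (p choose k) ^ 2"
      by (simp only: power_mult_distrib)
  qed
  moreover have "rat_of_nat (2 * p choose p) = (\<Sum>k=1..p - 1. of_nat (p choose k) ^ 2) + 2"
  proof -
    have "(\<Sum>k\<le>p. (p choose k) ^ 2) = (\<Sum>k\<in>{1..p - 1}. (p choose k) ^ 2) + 2"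
    proof -
      have "{..p} = insert 0 (insert p {1..p - 1})" using p_gt_3 by auto
      then show ?thesis using p_gt_3 by simp
    qed
    then have "rat_of_nat (2 * p choose p) = of_nat ((\<Sum>k\<in>{1..p - 1}. (p choose k) ^ 2) + 2)"
      by (simp only: choose_square_sum)
    then show ?thesis by simp
  qed
  ultimately have "rat_of_nat (2 * p choose p) - 2 \<approx>[3] 0" by simp
  from rat_cong_add[OF this rat_cong_refl[of 2]] show ?thesis by simp
qed

section \<open>The Euler number modulo p\<close>
abbreviation E :: rat where "E \<equiv> of_int (euler_number (p - 3))"

lemma sum_symmetric:
  fixes f :: "nat \<Rightarrow> 'b :: comm_monoid_add"
  shows "(\<Sum>k<p. f k) = f h + (\<Sum>j=1..h. f (h + j) + f (h - j))"
proof -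
  have "(\<Sum>k<2 * n + 1. f k) = f n + (\<Sum>j=1..n. f (n + j) + f (n - j))" for n
  proof -
    have "(\<Sum>k<2 * n + 1. f k) = (\<Sum>k<n. f k) + (\<Sum>k=n..<2 * n + 1. f k)"
      unfolding lessThan_atLeast0 by (rule sum.atLeastLessThan_concat [symmetric]) simp_all
    also have "(\<Sum>k=n..<2 * n + 1. f k) = f n + (\<Sum>k=Suc n..<2 * n + 1. f k)"
      by (rule sum.atLeast_Suc_lessThan) simp
    also have "(\<Sum>k<n. f k) = (\<Sum>j=1..n. f (n - j))"
      by (rule sum.reindex_bij_witness[of _ "\<lambda>j. n - j" "\<lambda>j. n - j"]) auto
    also have "(\<Sum>k=Suc n..<2 * n + 1. f k) = (\<Sum>j=1..n. f (n + j))"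
      by (rule sum.reindex_bij_witness[of _ "\<lambda>j. n + j" "\<lambda>j. j - n"]) auto
    finally show ?thesis unfolding sum.distrib by (simp only: add_ac)
  qed
  from this[of h] show ?thesis by (simp only: p_eq)
qed

text \<open>
  Modulo p the alternating sum of the (2k+1)^(p-3) over k < p equals the Euler number.  With
  k = h \<open>\<plusminus>\<close> j the base 2k+1 is p \<open>\<plusminus>\<close> 2j, and the even exponent p - 3 makes both powers congruent to
  1/(2j)^2 by Fermat's theorem, while the middle term is a positive power of p.
\<close>
lemma euler_number_cong: "2 * E \<approx>[1] \<epsilon> * (\<Sum>j=1..h. (- 1) ^ j / of_nat j ^ 2)"
proof -
  define f :: "nat \<Rightarrow> rat" where "f k = (- 1) ^ k * (2 * of_nat k + 1) ^ (p - 3)" for k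
  define S where "S = (\<Sum>k<p. f k)"
  have "2 * S \<approx>[1] E + E"
  proof -
    have "2 * S = E + (\<Sum>i=0..p - 3. of_nat (p - 3 choose i) * of_int (euler_number i) * (2 * P) ^ (p - 3 - i))"
      unfolding S_def f_def by (rule alternating_odd_power_sum) simp
    also have "\<dots> \<approx>[1] E + (\<Sum>i=0..p - 3. if i = p - 3 then E else 0)"
    proof (intro rat_cong_add rat_cong_refl rat_cong_sum)
      fix i assume i: "i \<in> {0..p - 3}"
      show "of_nat (p - 3 choose i) * of_int (euler_number i) * (2 * P) ^ (p - 3 - i) \<approx>[1] (if i = p - 3 then E else 0)"
      proof (cases "i = p - 3")
        case False
        then obtain m where m: "p - 3 - i = Suc m" using i by (cases "p - 3 - i") auto
        show ?thesis
          using False unfolding m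
          by (intro rat_cong_intro[of _ "of_nat (p - 3 choose i) * of_int (euler_number i) * 2 * (2 * P) ^ m"]) simp_all
      qed (simp add: rat_cong_refl)
    qed simp
    finally show ?thesis by simp
  qed
  then have "of_nat 2 * S \<approx>[1] of_nat 2 * E" by simp
  then have "S \<approx>[1] E" by (rule rat_cong_cancel) simp
  moreover have "S \<approx>[1] (\<Sum>j=1..h. \<epsilon> * (- 1) ^ j / of_nat ((2 * j) ^ 2) + \<epsilon> * (- 1) ^ j / of_nat ((2 * j) ^ 2))"
  proof -
    have "f h + (\<Sum>j=1..h. f (h + j) + f (h - j)) \<approx>[1]
        0 + (\<Sum>j=1..h. \<epsilon> * (- 1) ^ j / of_nat ((2 * j) ^ 2) + \<epsilon> * (- 1) ^ j / of_nat ((2 * j) ^ 2))"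
    proof (intro rat_cong_add rat_cong_sum)
      have "P ^ (p - 3) \<approx>[1] 0 ^ (p - 3)" by (intro rat_cong_power P_cong_0)
      then have "\<epsilon> * P ^ (p - 3) \<approx>[1] \<epsilon> * 0 ^ (p - 3)" by (intro rat_cong_mult_left) simp_all
      then show "f h \<approx>[1] 0" using p_gt_3 by (simp add: f_def P_eq power_0_left)
      fix j assume j: "j \<in> {1..h}"
      have even: "even (p - 3)" using p_gt_3 by simp
      have cop: "coprime (2 * j) p" using coprime_lt[of "2 * j"] j p_eq by auto
      have pow: "of_nat (2 * j) ^ (p - 3) \<approx>[1] 1 / of_nat ((2 * j) ^ 2)"
      proof (rule rat_cong_cancel)
        show "coprime ((2 * j) ^ 2) p" using cop by (simp only: coprime_power_left_iff simp_thms)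
        have "p - 1 = 2 + (p - 3)" using p_gt_3 by simp
        then have "of_nat ((2 * j) ^ 2) * of_nat (2 * j) ^ (p - 3) = (of_nat (2 * j) ^ (p - 1) :: rat)"
          by (simp only: power_add of_nat_power)
        then show "of_nat ((2 * j) ^ 2) * of_nat (2 * j) ^ (p - 3) \<approx>[1] of_nat ((2 * j) ^ 2) * (1 / of_nat ((2 * j) ^ 2) :: rat)"
          using fermat[OF cop] j by simp
      qed
      have main: "\<epsilon> * (- 1) ^ j * (P + x) ^ (p - 3) \<approx>[1] \<epsilon> * (- 1) ^ j / of_nat ((2 * j) ^ 2)"
        if x: "x = of_nat (2 * j) \<or> x = - of_nat (2 * j)" for x
      proof -
        have "p_integral x" using x by (auto simp del: of_nat_mult)
        then have "P + x \<approx>[1] 0 + x" by (intro rat_cong_add P_cong_0 rat_cong_refl)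
        then have "(P + x) ^ (p - 3) \<approx>[1] (0 + x) ^ (p - 3)" by (rule rat_cong_power)
        also have "(0 + x) ^ (p - 3) = of_nat (2 * j) ^ (p - 3)"
          using x even by (auto simp del: of_nat_mult)
        also note pow
        finally have "\<epsilon> * (- 1) ^ j * (P + x) ^ (p - 3) \<approx>[1] \<epsilon> * (- 1) ^ j * (1 / of_nat ((2 * j) ^ 2))"
          by (intro rat_cong_mult_left) simp_all
        then show ?thesis by simp
      qed
      have "f (h + j) = \<epsilon> * (- 1) ^ j * (P + of_nat (2 * j)) ^ (p - 3)"
        by (simp add: f_def P_eq power_add add_ac)
      then show "f (h + j) \<approx>[1] \<epsilon> * (- 1) ^ j / of_nat ((2 * j) ^ 2)"
        using main[of "of_nat (2 * j)"] by (simp only: simp_thms)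
      have "f (h - j) = \<epsilon> * (- 1) ^ j * (P + - of_nat (2 * j)) ^ (p - 3)"
      proof -
        have hj: "h - j + j = h" using j by simp
        have "\<epsilon> * (- 1) ^ j = ((- 1) ^ (h - j + j) * (- 1) ^ j :: rat)" by (simp only: hj)
        also have "\<dots> = (- 1) ^ (h - j)" by (simp add: power_add mult.assoc flip: power_mult_distrib)
        finally have "\<epsilon> * (- 1) ^ j = ((- 1) ^ (h - j) :: rat)" .
        moreover have "2 * of_nat (h - j) + 1 = P + - of_nat (2 * j)"
          using j by (simp add: P_eq of_nat_diff)
        ultimately show ?thesis by (simp only: f_def)
      qed
      then show "f (h - j) \<approx>[1] \<epsilon> * (- 1) ^ j / of_nat ((2 * j) ^ 2)"
        using main[of "- of_nat (2 * j)"] by (simp only: simp_thms)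
    qed
    then show ?thesis unfolding S_def sum_symmetric by simp
  qed
  ultimately have "E \<approx>[1] (\<Sum>j=1..h. \<epsilon> * (- 1) ^ j / of_nat ((2 * j) ^ 2) + \<epsilon> * (- 1) ^ j / of_nat ((2 * j) ^ 2))"
    by (meson rat_cong_sym rat_cong_trans)
  then have "2 * E \<approx>[1] 2 * (\<Sum>j=1..h. \<epsilon> * (- 1) ^ j / of_nat ((2 * j) ^ 2) + \<epsilon> * (- 1) ^ j / of_nat ((2 * j) ^ 2))"
    by (intro rat_cong_mult_left) simp_all
  also have "2 * (\<Sum>j=1..h. \<epsilon> * (- 1) ^ j / of_nat ((2 * j) ^ 2) + \<epsilon> * (- 1) ^ j / of_nat ((2 * j) ^ 2))
      = \<epsilon> * (\<Sum>j=1..h. (- 1) ^ j / of_nat j ^ 2)"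
    unfolding sum_distrib_left by (intro sum.cong refl) (simp add: power_mult_distrib)
  finally show ?thesis .
qed

lemma inverse_square_binomial_sum_cong:
  "(\<Sum>i=1..h. (- 1) ^ i / (of_nat i ^ 2 * of_nat (h choose i))) \<approx>[1] 4 * \<epsilon> * E"
proof -
  define A where "A = (\<Sum>j=1..h. (- 1) ^ j / rat_of_nat j ^ 2)"
  have "(\<Sum>i=1..h. (- 1) ^ i / (of_nat i ^ 2 * of_nat (h choose i))) = H2 + 2 * A"
    unfolding alternating_sum_inverse_square_binomial
    by (simp add: H2_def A_def add_divide_distrib sum.distrib sum_distrib_left)
  moreover have "A = \<epsilon> * (\<epsilon> * A)"
    by (simp add: mult.assoc [symmetric] sign_square)
  ultimately have "(\<Sum>i=1..h. (- 1) ^ i / (of_nat i ^ 2 * of_nat (h choose i))) = H2 + 2 * \<epsilon> * (\<epsilon> * A)"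
    by simp
  also have "\<dots> \<approx>[1] 0 + 2 * \<epsilon> * (2 * E)"
    by (intro rat_cong_add H2_cong_0 rat_cong_mult_left rat_cong_sym[OF euler_number_cong[folded A_def]]) simp
  finally show ?thesis by (simp add: mult.assoc)
qed

section \<open>The values at p - 1 and p modulo the cube of p\<close>

text \<open>The term with k = h + i in the alternating formula for S(p-1).\<close>
definition S_term :: "nat \<Rightarrow> rat" where
  "S_term i = of_nat ((2 * (h + i)) choose (h + i)) ^ 2 * of_nat ((h + i) choose (h - i)) * (- 4) ^ (h - i)"

text \<open>The residue modulo p that remains of a term with i > 0 after division by p^2.\<close>
definition S_term_residue :: "nat \<Rightarrow> rat" where
  "S_term_residue i = \<epsilon> * (- 1) ^ i / of_nat (4 * i ^ 2 * (h choose i))"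

lemma S_pred_prime: "of_nat (S_seq (p - 1)) = (\<Sum>i=0..h. S_term i)"
proof -
  define f :: "nat \<Rightarrow> rat" where
    "f k = of_nat ((2 * k) choose k) ^ 2 * of_nat (k choose (2 * h - k)) * (- 4) ^ (2 * h - k)" for k
  have "of_nat (S_seq (p - 1)) = (\<Sum>k=0..2 * h. f k)"
    unfolding p_pred_eq f_def by (rule S_seq_alternating)
  also have "\<dots> = (\<Sum>k=h..2 * h. f k)"
    by (rule sum.mono_neutral_right) (auto simp: f_def)
  also have "\<dots> = (\<Sum>i=0..h. S_term i)"
    by (rule sum.reindex_bij_witness[of _ "\<lambda>i. h + i" "\<lambda>k. k - h"]) (auto simp: f_def S_term_def mult_2)
  finally show ?thesis .
qed

text \<open>
  The factor (p + 2i)^2 comes from the central binomial coefficients.  At i = 0 it is p^2, which is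
  why p^2 divides all terms except the first one.
\<close>
lemma S_term_Suc:
  assumes "i < h"
  shows "of_nat (h + 1 + i) * (2 * of_nat i + 1) * (2 * of_nat i + 2) * S_term (Suc i)
    = - ((P + 2 * of_nat i) ^ 2 * of_nat (h - i) * S_term i)"
proof -
  obtain m where m: "h - i = Suc m" using assms by (metis Suc_diff_Suc)
  then have hm: "h - Suc i = m" "h + i = 2 * i + Suc m" by auto
  define k where "k = h + i"
  define c c' :: rat where "c = of_nat ((2 * k) choose k)" and "c' = of_nat ((2 * Suc k) choose Suc k)"
  have k: "k - m = 2 * i + 1" "Suc k - m = 2 * i + 2" using hm(2) by (auto simp: k_def)
  have "Suc m * (k choose Suc m) = (2 * i + 1) * (k choose m)"
    using binomial_Suc_right[of m k] k by simp
  moreover have "(2 * i + 2) * (Suc k choose m) = Suc k * (k choose m)"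
    using binomial_absorb_comp[of "Suc k" m] k by simp
  ultimately have "(2 * i + 1) * ((2 * i + 2) * (Suc k choose m)) = Suc k * (Suc m * (k choose Suc m))"
    by (simp only: mult.left_commute)
  then have bin: "(2 * of_nat i + 1) * ((2 * of_nat i + 2) * of_nat (Suc k choose m))
      = (of_nat (Suc k) * (of_nat (Suc m) * of_nat (k choose Suc m)) :: rat)"
    by (metis (mono_tags, lifting) of_nat_1 of_nat_add of_nat_mult of_nat_numeral)
  have P: "P + 2 * of_nat i = 2 * of_nat k + 1"
    by (simp add: P_eq k_def)
  have "of_nat (Suc k) * c' = 2 * (P + 2 * of_nat i) * c"
    unfolding c_def c'_def P by (rule central_binomial_Suc)
  then have cc: "(of_nat (Suc k) * c') ^ 2 = (2 * (P + 2 * of_nat i) * c) ^ 2" by simp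
  have t1: "S_term (Suc i) = c' ^ 2 * of_nat (Suc k choose m) * (- 4) ^ m"
    by (simp add: S_term_def c'_def k_def hm(1))
  have t0: "S_term i = c ^ 2 * of_nat (k choose Suc m) * (- 4) ^ Suc m"
    by (simp add: S_term_def c_def k_def m)
  have "of_nat (Suc k) * (of_nat (Suc k) * (2 * of_nat i + 1) * (2 * of_nat i + 2) * S_term (Suc i))
     = (of_nat (Suc k) * c') ^ 2 * ((2 * of_nat i + 1) * ((2 * of_nat i + 2) * of_nat (Suc k choose m))) * (- 4) ^ m"
    unfolding t1 by (simp only: power2_eq_square mult_ac)
  also have "\<dots> = (2 * (P + 2 * of_nat i) * c) ^ 2 * (of_nat (Suc k) * (of_nat (Suc m) * of_nat (k choose Suc m))) * (- 4) ^ m"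
    by (simp only: cc bin)
  also have "\<dots> = of_nat (Suc k) * (- ((P + 2 * of_nat i) ^ 2 * of_nat (Suc m) * S_term i))"
    unfolding t0 power_Suc power_mult_distrib by simp
  finally have "of_nat (Suc k) * (2 * of_nat i + 1) * (2 * of_nat i + 2) * S_term (Suc i)
     = - ((P + 2 * of_nat i) ^ 2 * of_nat (Suc m) * S_term i)"
    unfolding mult_cancel_left by (simp only: of_nat_eq_0_iff nat.distinct simp_thms)
  then show ?thesis by (simp only: m k_def) (simp add: add_ac)
qed

lemma S_term_0_cong: "S_term 0 \<approx>[3] \<epsilon> * u ^ 5"
proof -
  have "S_term 0 = of_nat (p - 1 choose h) ^ 2 * (\<epsilon> * u)"
    by (simp only: S_term_def p_pred_eq power_mult) (simp flip: power_mult_distrib)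
  also have "\<dots> \<approx>[3] (\<epsilon> * u ^ 2) ^ 2 * (\<epsilon> * u)"
    by (intro rat_cong_mult rat_cong_power morley rat_cong_refl) simp
  also have "(\<epsilon> * u ^ 2) ^ 2 * (\<epsilon> * u) = (\<epsilon> * \<epsilon>) * \<epsilon> * (u ^ 2 * u ^ 2 * u)"
    by (simp only: power2_eq_square mult_ac)
  also have "\<dots> = \<epsilon> * u ^ 5"
    unfolding sign_square by (simp add: power2_eq_square eval_nat_numeral)
  finally show ?thesis .
qed

lemma S_term_0_cong_sign: "S_term 0 \<approx>[1] \<epsilon>"
proof -
  have "S_term 0 \<approx>[1] \<epsilon> * u ^ 5" by (rule rat_cong_lower[OF S_term_0_cong]) simp
  also have "\<dots> \<approx>[1] \<epsilon> * 1 ^ 5" by (intro rat_cong_mult_left rat_cong_power u_cong_1) simp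
  finally show ?thesis by simp
qed

lemma S_term_residue_Suc:
  assumes "0 < i" "i < h"
  shows "of_nat (h - i) * of_nat (Suc i) * S_term_residue (Suc i) = - (of_nat i ^ 2 * S_term_residue i)"
proof -
  have "rat_of_nat (Suc i * (h choose Suc i)) = of_nat ((h - i) * (h choose i))"
    by (simp only: binomial_Suc_right)
  then have bin: "rat_of_nat (Suc i) * of_nat (h choose Suc i) = of_nat (h - i) * of_nat (h choose i)"
    by (simp only: of_nat_mult)
  have nz: "rat_of_nat (h - i) \<noteq> 0" "rat_of_nat (h choose i) \<noteq> 0" "rat_of_nat (h choose Suc i) \<noteq> 0"
    "rat_of_nat (Suc i) \<noteq> 0" "rat_of_nat i \<noteq> 0"
    using assms by (simp_all del: of_nat_Suc)
  have "of_nat (h - i) * of_nat (Suc i) * S_term_residue (Suc i)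
      = - (\<epsilon> * (- 1) ^ i * of_nat (h - i) / (4 * (of_nat (Suc i) * of_nat (h choose Suc i))))"
    unfolding S_term_residue_def of_nat_mult of_nat_power power_Suc using nz(4)
    by (simp add: power2_eq_square divide_simps del: of_nat_Suc)
  also have "\<dots> = - (\<epsilon> * (- 1) ^ i / (4 * of_nat (h choose i)))"
    unfolding bin using nz by (simp del: of_nat_Suc)
  also have "\<dots> = - (of_nat i ^ 2 * S_term_residue i)"
    using nz by (simp add: S_term_residue_def)
  finally show ?thesis .
qed

text \<open>
  Induction on i along the two quotients of consecutive terms, which agree modulo p because
  2h \<equiv> -1 turns h + 1 + i into (2i+1)/2 and h - i into -(2i+1)/2.
\<close>
lemma S_term_div_p_square:
  assumes "i \<in> {1..h}"
  shows "\<exists>\<tau>. S_term i = P ^ 2 * \<tau> \<and> \<tau> \<approx>[1] S_term_residue i"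
proof -
  have "Suc n \<le> h \<Longrightarrow> \<exists>\<tau>. S_term (Suc n) = P ^ 2 * \<tau> \<and> \<tau> \<approx>[1] S_term_residue (Suc n)" for n
  proof (induction n)
    case 0
    have h0: "0 < h" using h_gt_1 by simp
    then have nz: "rat_of_nat h \<noteq> 0" "rat_of_nat h + 1 \<noteq> 0"
      by (simp_all add: add_nonneg_eq_0_iff)
    define \<tau> where "\<tau> = - (of_nat h * S_term 0) / of_nat (2 * (h + 1))"
    have "S_term (Suc 0) = P ^ 2 * \<tau>"
      using S_term_Suc[OF h0] nz unfolding \<tau>_def by (simp add: field_simps)
    moreover have "\<tau> \<approx>[1] S_term_residue (Suc 0)"
    proof (rule rat_cong_cancel)
      have "coprime h p" "coprime (h + 1) p"
        using coprime_lt[of h] coprime_lt[of "h + 1"] p_eq h_gt_1 by auto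
      then show "coprime (4 * (h * (h + 1))) p"
        by (simp only: coprime_mult_left_iff coprime_4 simp_thms)
      have "of_nat (4 * (h * (h + 1))) * \<tau> = - 2 * of_nat h ^ 2 * S_term 0"
        using nz unfolding \<tau>_def by (simp add: divide_simps power2_eq_square) (simp add: algebra_simps)
      also have "\<dots> \<approx>[1] - 2 * of_nat h ^ 2 * \<epsilon>"
        by (intro rat_cong_mult_left S_term_0_cong_sign) simp
      \<comment> \<open>The difference of the factors is (2h + 1)(1 - h), and 2h + 1 = p.\<close>
      also have "\<dots> \<approx>[1] - (of_nat h + 1) * \<epsilon>"
        by (intro rat_cong_intro[of _ "(1 - of_nat h) * \<epsilon>"])
          (simp_all add: P_eq power2_eq_square algebra_simps)
      also have "\<dots> = of_nat (4 * (h * (h + 1))) * S_term_residue (Suc 0)"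
        using nz unfolding S_term_residue_def by (simp add: divide_simps) (simp add: algebra_simps)
      finally show "of_nat (4 * (h * (h + 1))) * \<tau> \<approx>[1] of_nat (4 * (h * (h + 1))) * S_term_residue (Suc 0)" .
    qed
    ultimately show ?case by blast
  next
    case (Suc n)
    define i where "i = Suc n"
    have i: "0 < i" "i < h" using Suc.prems by (simp_all add: i_def)
    obtain \<tau> where \<tau>: "S_term i = P ^ 2 * \<tau>" "\<tau> \<approx>[1] S_term_residue i"
      using Suc by (auto simp: i_def)
    define N where "N = (h + 1 + i) * (2 * i + 1) * (2 * i + 2)"
    define X where "X = (P + 2 * of_nat i) ^ 2 * of_nat (h - i)"
    define \<tau>' where "\<tau>' = - (X * \<tau>) / of_nat N"
    have N: "of_nat N = (of_nat (h + 1 + i) * (2 * of_nat i + 1) * (2 * of_nat i + 2) :: rat)"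
      unfolding N_def of_nat_mult of_nat_add by simp
    have N0: "rat_of_nat N \<noteq> 0" by (simp add: N_def del: of_nat_mult of_nat_add)
    have "of_nat N * S_term (Suc i) = - (X * S_term i)"
      unfolding N X_def using S_term_Suc[OF i(2)] by simp
    then have "S_term (Suc i) = P ^ 2 * \<tau>'"
      using N0 unfolding \<tau>'_def \<tau>(1) by (simp add: field_simps)
    moreover have "\<tau>' \<approx>[1] S_term_residue (Suc i)"
    proof (rule rat_cong_cancel)
      have "coprime (h + 1 + i) p" "coprime (2 * i + 1) p" "coprime (2 * i + 2) p" "coprime (h - i) p"
        using coprime_lt[of "h + 1 + i"] coprime_lt[of "2 * i + 1"] coprime_lt[of "2 * i + 2"]
          coprime_lt[of "h - i"] i p_eq by auto
      then show "coprime (N * (h - i)) p" unfolding N_def coprime_mult_left_iff by blast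
      define Y where "Y = 2 * (2 * of_nat i + 1) * rat_of_nat (h + 1 + i) * of_nat i ^ 2"
      have "of_nat (N * (h - i)) * \<tau>' = - (X * of_nat (h - i)) * \<tau>"
        using N0 by (simp add: \<tau>'_def)
      also have "\<dots> \<approx>[1] - Y * S_term_residue i"
      proof (intro rat_cong_mult rat_cong_minus \<tau>(2))
        define q x :: rat where "q = 2 * of_nat i + 1" and "x = of_nat i"
        have hi: "rat_of_nat (h - i) = (P - q) / 2"
          using i by (simp add: of_nat_diff P_eq q_def)
        have hi': "rat_of_nat (h + 1 + i) = (P + q) / 2"
          by (simp add: P_eq q_def)
        have "X * of_nat (h - i) = Y + P ^ 1 * ((P * (P - 1) ^ 2 - 4 * x * q * (P - 1) - 4 * x ^ 2 * q) / 4)"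
          unfolding X_def Y_def hi hi' x_def [symmetric]
          by (simp add: q_def x_def power2_eq_square field_simps)
        then show "X * of_nat (h - i) \<approx>[1] Y"
          by (rule rat_cong_intro[rotated -1]) (simp_all add: Y_def q_def x_def)
      qed
      also have "- Y * S_term_residue i = 2 * (2 * of_nat i + 1) * rat_of_nat (h + 1 + i) * (of_nat (h - i) * of_nat (Suc i) * S_term_residue (Suc i))"
        unfolding S_term_residue_Suc[OF i] Y_def by simp
      also have "\<dots> = of_nat (N * (h - i)) * S_term_residue (Suc i)"
        unfolding of_nat_mult N by (simp add: algebra_simps)
      finally show "of_nat (N * (h - i)) * \<tau>' \<approx>[1] of_nat (N * (h - i)) * S_term_residue (Suc i)" .
    qed
    ultimately show ?case unfolding i_def by blast
  qed
  from this[of "i - 1"] show ?thesis using assms by simp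
qed

lemma S_term_cong: "i \<in> {1..h} \<Longrightarrow> S_term i \<approx>[3] P ^ 2 * S_term_residue i"
  using S_term_div_p_square[of i] rat_cong_lift[of 1 _ "S_term_residue i" 2] by auto

lemma S_pred_prime_cong: "of_nat (S_seq (p - 1)) \<approx>[3] \<epsilon> * u ^ 5 + P ^ 2 * E"
proof -
  define T :: rat where "T = (\<Sum>i=1..h. (- 1) ^ i / (of_nat i ^ 2 * of_nat (h choose i)))"
  have T: "T \<approx>[1] 4 * \<epsilon> * E"
    unfolding T_def by (rule inverse_square_binomial_sum_cong)
  have "(\<Sum>i=1..h. S_term_residue i) = \<epsilon> * T / of_nat 4"
    unfolding T_def sum_distrib_left sum_divide_distrib by (intro sum.cong refl) (simp add: S_term_residue_def)
  also have "\<dots> \<approx>[1] \<epsilon> * (4 * \<epsilon> * E) / of_nat 4"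
    using coprime_4 by (intro rat_cong_divide rat_cong_mult_left T) simp_all
  also have "\<epsilon> * (4 * \<epsilon> * E) / of_nat 4 = (\<epsilon> * \<epsilon>) * E" by simp
  finally have "P ^ 2 * (\<Sum>i=1..h. S_term_residue i) \<approx>[2 + 1] P ^ 2 * E"
    unfolding sign_square mult_1 by (rule rat_cong_lift)
  then have residue_sum: "P ^ 2 * (\<Sum>i=1..h. S_term_residue i) \<approx>[3] P ^ 2 * E" by simp
  have "of_nat (S_seq (p - 1)) = S_term 0 + (\<Sum>i=1..h. S_term i)"
    unfolding S_pred_prime by (simp add: sum.atLeast_Suc_atMost)
  also have "\<dots> \<approx>[3] \<epsilon> * u ^ 5 + (\<Sum>i=1..h. P ^ 2 * S_term_residue i)"
    by (intro rat_cong_add S_term_0_cong rat_cong_sum S_term_cong)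
  also have "\<dots> \<approx>[3] \<epsilon> * u ^ 5 + P ^ 2 * E"
    unfolding sum_distrib_left [symmetric] by (intro rat_cong_add residue_sum rat_cong_refl) simp
  finally show ?thesis .
qed

text \<open>
  Replacing p - 1 by p in the alternating formula multiplies the term with index k = h + i by
  -8i/(h + 1 - i) for 0 < i \<le> h, removes the one with i = 0 and adds the one with k = p.
\<close>
lemma S_prime_terms:
  "of_nat (S_seq p) = (\<Sum>i=1..h. - 8 * of_nat i * S_term i / of_nat (h + 1 - i)) + of_nat (2 * p choose p) ^ 2"
proof -
  define f :: "nat \<Rightarrow> rat" where
    "f k = of_nat ((2 * k) choose k) ^ 2 * of_nat (k choose (p - k)) * (- 4) ^ (p - k)" for k
  have "of_nat (S_seq p) = (\<Sum>k=0..p. f k)"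
    unfolding f_def by (rule S_seq_alternating)
  also have "\<dots> = (\<Sum>k=h + 1..p. f k)"
  proof (rule sum.mono_neutral_right)
    show "\<forall>k\<in>{0..p} - {h + 1..p}. f k = 0"
    proof
      fix k assume "k \<in> {0..p} - {h + 1..p}"
      then have "k < p - k" using p_eq by auto
      then show "f k = 0" by (simp add: f_def)
    qed
  qed auto
  also have "{h + 1..p} = insert p {h + 1..h + h}" using p_eq by auto
  also have "sum f (insert p {h + 1..h + h}) = (\<Sum>k=h + 1..h + h. f k) + f p"
    using p_eq by (subst sum.insert) auto
  also have "(\<Sum>k=h + 1..h + h. f k) = (\<Sum>i=1..h. f (h + i))"
    by (rule sum.reindex_bij_witness[of _ "\<lambda>i. h + i" "\<lambda>k. k - h"]) auto
  also have "\<dots> = (\<Sum>i=1..h. - 8 * of_nat i * S_term i / of_nat (h + 1 - i))"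
  proof (intro sum.cong refl)
    fix i assume i: "i \<in> {1..h}"
    define j where "j = h - i"
    have j: "p - (h + i) = Suc j" "h + 1 - i = Suc j" "h + i - j = 2 * i"
      using i p_eq by (auto simp: j_def)
    have "rat_of_nat (Suc j * ((h + i) choose Suc j)) = of_nat (2 * i * ((h + i) choose j))"
      by (simp only: binomial_Suc_right j)
    then have "rat_of_nat ((h + i) choose Suc j) = 2 * of_nat i * of_nat ((h + i) choose j) / of_nat (Suc j)"
      unfolding of_nat_mult by (simp add: field_simps del: of_nat_Suc)
    then show "f (h + i) = - 8 * of_nat i * S_term i / of_nat (h + 1 - i)"
      unfolding f_def S_term_def j j_def [symmetric] by simp
  qed
  finally show ?thesis by (simp add: f_def)
qed

text \<open>
  After division by p^2 and the reflection of i to h + 1 - i, the terms with k < p are congruent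
  modulo p to twice (-1)^i / (i^2 C(h,i)).
\<close>
lemma S_prime_cong: "of_nat (S_seq p) \<approx>[3] 4 + 8 * \<epsilon> * P ^ 2 * E"
proof -
  define g :: "nat \<Rightarrow> rat" where "g i = (- 1) ^ i / (of_nat i ^ 2 * of_nat (h choose i))" for i
  have "- 8 * of_nat i * S_term i / of_nat (h + 1 - i) \<approx>[3] P ^ 2 * (2 * g (h + 1 - i))" if i: "i \<in> {1..h}" for i
  proof -
    have "coprime (h + 1 - i) p" using i p_eq coprime_lt[of "h + 1 - i"] by auto
    then have "- 8 * of_nat i * S_term i / of_nat (h + 1 - i) \<approx>[3] - 8 * of_nat i * (P ^ 2 * S_term_residue i) / of_nat (h + 1 - i)"
      using i by (intro rat_cong_divide rat_cong_mult_left S_term_cong) simp_all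
    also have "- 8 * of_nat i * (P ^ 2 * S_term_residue i) / of_nat (h + 1 - i) = P ^ 2 * (2 * g (h + 1 - i))"
    proof -
      define j where "j = h + 1 - i"
      obtain m where m: "i = Suc m" using i by (cases i) auto
      have hm: "h - m = j" "m \<le> h" "j \<noteq> 0" using i m by (auto simp: j_def)
      have "rat_of_nat (Suc m * (h choose Suc m)) = of_nat ((h - m) * (h choose m))"
        by (simp only: binomial_Suc_right)
      then have bin: "of_nat i * of_nat (h choose i) = (of_nat j * of_nat (h choose j) :: rat)"
        unfolding m of_nat_mult hm(1) binomial_symmetric[OF hm(2)] .
      have "even (h + i + 1 + j)" using i by (auto simp: j_def)
      then have sign: "(- 1) ^ j = - (\<epsilon> * (- 1) ^ i :: rat)"
        by (auto simp: minus_one_power_iff)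
      have nz: "rat_of_nat i \<noteq> 0" using m by simp
      have "- 8 * of_nat i * S_term_residue i = 2 * (- (\<epsilon> * (- 1) ^ i)) / (of_nat i * of_nat (h choose i))"
        using nz by (simp add: S_term_residue_def power2_eq_square)
      also have "\<dots> = 2 * (- 1) ^ j / (of_nat j * of_nat (h choose j))"
        by (simp only: bin sign)
      finally have "- 8 * of_nat i * S_term_residue i / of_nat j = 2 * g j"
        by (simp add: g_def power2_eq_square)
      moreover have "- 8 * of_nat i * (P ^ 2 * S_term_residue i) / of_nat j = P ^ 2 * (- 8 * of_nat i * S_term_residue i / of_nat j)"
        by simp
      ultimately show ?thesis by (simp only: j_def)
    qed
    finally show ?thesis .
  qed
  then have "(\<Sum>i=1..h. - 8 * of_nat i * S_term i / of_nat (h + 1 - i)) \<approx>[3] (\<Sum>i=1..h. P ^ 2 * (2 * g (h + 1 - i)))"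
    by (rule rat_cong_sum)
  also have "(\<Sum>i=1..h. P ^ 2 * (2 * g (h + 1 - i))) = P ^ 2 * (2 * (\<Sum>i=1..h. g i))"
    unfolding sum_distrib_left [symmetric]
    by (subst (2) sum.atLeastAtMost_rev) (simp add: add.commute)
  also have "\<dots> \<approx>[3] P ^ 2 * (2 * (4 * \<epsilon> * E))"
  proof -
    have "P ^ 2 * (2 * (\<Sum>i=1..h. g i)) \<approx>[2 + 1] P ^ 2 * (2 * (4 * \<epsilon> * E))"
      unfolding g_def by (intro rat_cong_lift rat_cong_mult_left inverse_square_binomial_sum_cong) simp
    then show ?thesis by simp
  qed
  finally have "(\<Sum>i=1..h. - 8 * of_nat i * S_term i / of_nat (h + 1 - i)) + of_nat (2 * p choose p) ^ 2
      \<approx>[3] P ^ 2 * (2 * (4 * \<epsilon> * E)) + 2 ^ 2"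
    using wolstenholme by (intro rat_cong_add rat_cong_power) simp_all
  then show ?thesis
    unfolding S_prime_terms by (simp add: algebra_simps)
qed

section \<open>The sums modulo the fifth power of p\<close>

text \<open>
  The factor p^2 in front leaves the bracket to be determined modulo p^3.  There the squares
  S(p)^2 and S(p-1)^2 carry p^2 and count as 16 and 1, every power of 2^(p-1) next to p^2 counts
  as 1, and the contribution 12 E(p-3) is 4 E(p-3) from S(p-1) plus 8 E(p-3) from S(p).
\<close>
lemma telescoped_sum_cong:
  fixes a b\<^sub>0 b\<^sub>1 b\<^sub>2 c M :: rat and q :: "rat \<Rightarrow> rat"
  assumes M: "M = 2 ^ r"
    and int: "p_integral a" "p_integral b\<^sub>0" "p_integral b\<^sub>1" "p_integral b\<^sub>2" "p_integral c"
    and step: "\<And>N x y :: rat. let z = 4 * (3 * N ^ 2 + 3 * N + 1) * x - 32 * N ^ 2 * y in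
      a * z ^ 2 + (b\<^sub>0 + b\<^sub>1 * (N + 1) + b\<^sub>2 * (N + 1) ^ 2) * z * x + c * (N + 1) ^ 4 * x ^ 2
      = q N * x ^ 2 + M * (a * N ^ 4 * x ^ 2 + (b\<^sub>0 + b\<^sub>1 * N + b\<^sub>2 * N ^ 2) * N ^ 2 * x * y + c * N ^ 4 * y ^ 2)"
  shows "(\<Sum>n=0..p - 1. q (of_nat n) * (of_nat (S_seq n) ^ 2 / M ^ n)) \<approx>[5]
    P ^ 2 * ((16 * a + c + 12 * b\<^sub>0 * E) * P ^ 2 + 4 * \<epsilon> * (b\<^sub>0 + b\<^sub>1 * P + b\<^sub>2 * P ^ 2) * (u ^ 5 / u ^ r))"
proof -
  define s s' where "s = rat_of_nat (S_seq p)" and "s' = rat_of_nat (S_seq (p - 1))"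
  define v where "v = 1 / u ^ r"
  define b where "b = b\<^sub>0 + b\<^sub>1 * P + b\<^sub>2 * P ^ 2"
  have b_int: "p_integral b" using int by (simp add: b_def)
  have u0: "u \<noteq> 0" by simp
  have v_int: "p_integral v"
    using p_integral_divide[of 1 "2 ^ ((p - 1) * r)"] by (simp add: v_def power_mult)
  have v1: "v \<approx>[1] 1"
  proof -
    have "u ^ r \<approx>[1] 1 ^ r" by (intro rat_cong_power u_cong_1)
    then have "1 / u ^ r \<approx>[1] 1 / 1 ^ r"
      using v_int u0 by (intro rat_cong_inverse) (simp_all add: v_def)
    then show ?thesis by (simp add: v_def)
  qed
  have s3: "s \<approx>[3] 4 + 8 * \<epsilon> * P ^ 2 * E" unfolding s_def by (rule S_prime_cong)
  have s'3: "s' \<approx>[3] \<epsilon> * u ^ 5 + P ^ 2 * E" unfolding s'_def by (rule S_pred_prime_cong)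
  have P2: "P ^ 2 * x \<approx>[3] P ^ 2 * y" if "x \<approx>[1] y" for x y
    using rat_cong_lift[OF that, of 2] by simp
  have s1: "s \<approx>[1] 4"
  proof -
    have "s \<approx>[1] 4 + 8 * \<epsilon> * P ^ 2 * E" by (rule rat_cong_lower[OF s3]) simp
    also have "\<dots> \<approx>[1] 4"
      by (intro rat_cong_intro[of _ "8 * \<epsilon> * P * E"]) (simp_all add: power2_eq_square)
    finally show ?thesis .
  qed
  have s'1: "s' \<approx>[1] \<epsilon>"
  proof -
    have "s' \<approx>[1] \<epsilon> * u ^ 5 + P ^ 2 * E" by (rule rat_cong_lower[OF s'3]) simp
    also have "\<dots> \<approx>[1] \<epsilon> * 1 ^ 5 + 0 ^ 2 * E"
      by (intro rat_cong_add rat_cong_mult rat_cong_power u_cong_1 P_cong_0 rat_cong_refl) simp_all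
    finally show ?thesis by simp
  qed
  have A: "a * (P ^ 2 * (s ^ 2 * v)) \<approx>[3] a * (P ^ 2 * 16)"
  proof (rule rat_cong_mult_left[OF int(1) P2])
    have "s ^ 2 * v \<approx>[1] 4 ^ 2 * 1" by (intro rat_cong_mult rat_cong_power s1 v1)
    then show "s ^ 2 * v \<approx>[1] 16" by simp
  qed
  have C: "c * (P ^ 2 * (s' ^ 2 * v)) \<approx>[3] c * (P ^ 2 * 1)"
  proof (rule rat_cong_mult_left[OF int(5) P2])
    have "s' ^ 2 * v \<approx>[1] \<epsilon> ^ 2 * 1" by (intro rat_cong_mult rat_cong_power s'1 v1)
    then show "s' ^ 2 * v \<approx>[1] 1" by (simp only: power2_eq_square sign_square mult_1)
  qed
  have "s * s' * v \<approx>[3] (4 + 8 * \<epsilon> * P ^ 2 * E) * (\<epsilon> * u ^ 5 + P ^ 2 * E) * v"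
    by (intro rat_cong_mult s3 s'3 rat_cong_refl v_int)
  also have "(4 + 8 * \<epsilon> * P ^ 2 * E) * (\<epsilon> * u ^ 5 + P ^ 2 * E) * v
      = 4 * \<epsilon> * (u ^ 5 * v) + P ^ 2 * (4 * E * v + 8 * (\<epsilon> * \<epsilon>) * E * (u ^ 5 * v) + 8 * \<epsilon> * P ^ 2 * E ^ 2 * v)"
    by (simp only: power2_eq_square ring_distribs mult_ac add_ac)
  also have "\<dots> \<approx>[3] 4 * \<epsilon> * (u ^ 5 * v) + P ^ 2 * (4 * E * 1 + 8 * (\<epsilon> * \<epsilon>) * E * (1 ^ 5 * 1) + 8 * \<epsilon> * 0 ^ 2 * E ^ 2 * 1)"
  proof (rule rat_cong_add[OF rat_cong_refl P2])
    show "4 * E * v + 8 * (\<epsilon> * \<epsilon>) * E * (u ^ 5 * v) + 8 * \<epsilon> * P ^ 2 * E ^ 2 * v \<approx>[1]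
        4 * E * 1 + 8 * (\<epsilon> * \<epsilon>) * E * (1 ^ 5 * 1) + 8 * \<epsilon> * 0 ^ 2 * E ^ 2 * 1"
      by (intro rat_cong_add rat_cong_mult rat_cong_power u_cong_1 v1 P_cong_0 rat_cong_refl) simp_all
  qed (use v_int in simp_all)
  also have "\<dots> = 4 * \<epsilon> * (u ^ 5 * v) + P ^ 2 * (12 * E)"
    unfolding sign_square by simp
  finally have "b * (s * s' * v) \<approx>[3] b * (4 * \<epsilon> * (u ^ 5 * v) + P ^ 2 * (12 * E))"
    by (rule rat_cong_mult_left[OF b_int])
  also have "\<dots> = 4 * \<epsilon> * b * (u ^ 5 * v) + P ^ 2 * (12 * b * E)" by (simp add: algebra_simps)
  also have "\<dots> \<approx>[3] 4 * \<epsilon> * b * (u ^ 5 * v) + P ^ 2 * (12 * b\<^sub>0 * E)"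
  proof (rule rat_cong_add[OF rat_cong_refl P2])
    have "b \<approx>[1] b\<^sub>0"
      using int by (intro rat_cong_intro[of _ "b\<^sub>1 + b\<^sub>2 * P"]) (simp_all add: b_def power2_eq_square algebra_simps)
    then show "12 * b * E \<approx>[1] 12 * b\<^sub>0 * E"
      by (intro rat_cong_mult rat_cong_refl) simp_all
  qed (use b_int v_int in simp_all)
  finally have B: "b * (s * s' * v) \<approx>[3] 4 * \<epsilon> * b * (u ^ 5 * v) + P ^ 2 * (12 * b\<^sub>0 * E)" .
  have "(\<Sum>n=0..p - 1. q (of_nat n) * (of_nat (S_seq n) ^ 2 / M ^ n)) =
      (a * P ^ 4 * s ^ 2 + b * P ^ 2 * s * s' + c * P ^ 4 * s' ^ 2) / M ^ (p - 1)"
    using S_telescope[of M a b\<^sub>0 b\<^sub>1 b\<^sub>2 c q "p - 1", OF _ step] p_gt_3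
    by (simp add: M s_def s'_def b_def)
  also have "M ^ (p - 1) = u ^ r"
    by (simp add: M mult.commute flip: power_mult)
  also have "(a * P ^ 4 * s ^ 2 + b * P ^ 2 * s * s' + c * P ^ 4 * s' ^ 2) / u ^ r
      = P ^ 2 * (a * (P ^ 2 * (s ^ 2 * v)) + b * (s * s' * v) + c * (P ^ 2 * (s' ^ 2 * v)))"
    by (simp add: v_def add_divide_distrib power2_eq_square power4_eq_xxxx algebra_simps)
  also have "\<dots> \<approx>[2 + 3] P ^ 2 * (a * (P ^ 2 * 16)
      + (4 * \<epsilon> * b * (u ^ 5 * v) + P ^ 2 * (12 * b\<^sub>0 * E)) + c * (P ^ 2 * 1))"
    by (intro rat_cong_lift rat_cong_add A B C)
  also have "P ^ 2 * (a * (P ^ 2 * 16) + (4 * \<epsilon> * b * (u ^ 5 * v) + P ^ 2 * (12 * b\<^sub>0 * E)) + c * (P ^ 2 * 1))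
      = P ^ 2 * ((16 * a + c + 12 * b\<^sub>0 * E) * P ^ 2 + 4 * \<epsilon> * b * (u ^ 5 / u ^ r))"
    by (simp add: v_def algebra_simps)
  finally show ?thesis by (simp add: b_def)
qed

end

theorem theorem4p7:
  fixes p :: nat
  assumes "prime p" and "p > 3"
  defines "P \<equiv> (of_nat p :: rat)"
      and "e \<equiv> ((- 1) ^ ((p - 1) div 2) :: rat)"
      and "E \<equiv> (of_int (euler_number (p - 3)) :: rat)"
  shows
    "rat_cong p 5
       (\<Sum>n=0..p - 1. ((2 * of_nat n + 1) ^ 3 - 5 * (2 * of_nat n + 1))
                     * (of_nat (S_seq n) ^ 2 / 32 ^ n))
       (- 4 * e * P ^ 2 + (24 * (e - 1) - 12 * E) * P ^ 4)
    \<and>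
    rat_cong p 5
       (\<Sum>n=0..p - 1. (18 * of_nat n ^ 3 - 21 * of_nat n ^ 2 - 18 * of_nat n - 4)
                     * (of_nat (S_seq n) ^ 2 / 64 ^ n))
       (18 * P ^ 4 - e * P ^ 2 * (18 * P ^ 2 + 6 * P - 2) * 2 powi (1 - int p)
          + 6 * P ^ 4 * E)
    \<and>
    rat_cong p 5
       (\<Sum>n=0..p - 1. (18 * of_nat n ^ 3 + 75 * of_nat n ^ 2 + 78 * of_nat n + 25)
                     * (of_nat (S_seq n) ^ 2 / 16 ^ n))
       (45 * P ^ 4 - 4 * e * P ^ 2 * (9 * P ^ 2 - 3 * P - 1) * 2 ^ (p - 1)
          + 12 * P ^ 4 * E)
    \<and>
    rat_cong p 5
       (\<Sum>n=0..p - 1. (10634085 * of_nat n ^ 4 + 45622368 * of_nat n ^ 3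
                      + 70689360 * of_nat n ^ 2 + 47911968 * of_nat n + 12084400)
                     * of_nat (S_seq n) ^ 2)
       (- 1024 * e * P ^ 2 * (1089 * P ^ 2 - 1023 * P + 299) * 32 ^ (p - 1)
          + (12458160 - 918528 * E) * P ^ 4)"
proof -
  interpret prime_gt_3 p by unfold_locales (use assms in auto)
  define u :: rat where "u = 2 ^ (p - 1)"
  have u0: "u \<noteq> 0" by (simp add: u_def)
  have e: "(- 1) ^ h = e" by (simp add: h_def e_def)
  have p_integral_16: "p_integral (x / 16)" if "p_integral x" for x
    using p_integral_divide[OF that coprime_numerals(3)[of 4]] by simp
  note folds = e u_def [symmetric] P_def [symmetric] E_def [symmetric]
  \<comment> \<open>For each pair of a polynomial and a base, the coefficients of the telescoping form are the
    solution of the linear system obtained by comparing coefficients in the polynomial identity.\<close>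
  have one: "(\<Sum>n=0..p - 1. ((2 * of_nat n + 1) ^ 3 - 5 * (2 * of_nat n + 1)) * (of_nat (S_seq n) ^ 2 / 32 ^ n)) \<approx>[5]
     P ^ 2 * ((16 * (- (1 / 2)) + (- 16) + 12 * (- 1) * E) * P ^ 2 + 4 * e * (- 1 + 0 * P + 6 * P ^ 2) * (u ^ 5 / u ^ 5))"
    unfolding folds [symmetric]
    by (rule telescoped_sum_cong[where q = "\<lambda>x. (2 * x + 1) ^ 3 - 5 * (2 * x + 1)"])
       (simp_all add: Let_def, simp add: power2_eq_square power3_eq_cube power4_eq_xxxx field_simps)
  have two: "(\<Sum>n=0..p - 1. (18 * of_nat n ^ 3 - 21 * of_nat n ^ 2 - 18 * of_nat n - 4) * (of_nat (S_seq n) ^ 2 / 64 ^ n)) \<approx>[5]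
     P ^ 2 * ((16 * (9 / 16) + 9 + 12 * (1 / 2) * E) * P ^ 2 + 4 * e * (1 / 2 + (- (3 / 2)) * P + (- (9 / 2)) * P ^ 2) * (u ^ 5 / u ^ 6))"
    unfolding folds [symmetric]
    by (rule telescoped_sum_cong[where q = "\<lambda>x. 18 * x ^ 3 - 21 * x ^ 2 - 18 * x - 4"])
       (simp_all add: Let_def p_integral_16, simp add: power2_eq_square power3_eq_cube power4_eq_xxxx field_simps)
  have three: "(\<Sum>n=0..p - 1. (18 * of_nat n ^ 3 + 75 * of_nat n ^ 2 + 78 * of_nat n + 25) * (of_nat (S_seq n) ^ 2 / 16 ^ n)) \<approx>[5]
     P ^ 2 * ((16 * (9 / 16) + 36 + 12 * 1 * E) * P ^ 2 + 4 * e * (1 + 3 * P + (- 9) * P ^ 2) * (u ^ 5 / u ^ 4))"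
    unfolding folds [symmetric]
    by (rule telescoped_sum_cong[where q = "\<lambda>x. 18 * x ^ 3 + 75 * x ^ 2 + 78 * x + 25"])
       (simp_all add: Let_def p_integral_16, simp add: power2_eq_square power3_eq_cube power4_eq_xxxx field_simps)
  have four: "(\<Sum>n=0..p - 1. (10634085 * of_nat n ^ 4 + 45622368 * of_nat n ^ 3
        + 70689360 * of_nat n ^ 2 + 47911968 * of_nat n + 12084400) * (of_nat (S_seq n) ^ 2 / 1 ^ n)) \<approx>[5]
     P ^ 2 * ((16 * 11979 + 12266496 + 12 * (- 76544) * E) * P ^ 2 + 4 * e * (- 76544 + 261888 * P + (- 278784) * P ^ 2) * (u ^ 5 / u ^ 0))"
    unfolding folds [symmetric]
    by (rule telescoped_sum_cong[where q = "\<lambda>x. 10634085 * x ^ 4 + 45622368 * x ^ 3 + 70689360 * x ^ 2 + 47911968 * x + 12084400"])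
       (simp_all add: Let_def, simp add: power2_eq_square power3_eq_cube power4_eq_xxxx field_simps)
  have u_powi: "2 powi (1 - int p) = 1 / u"
  proof -
    have "1 - int p = - int (p - 1)" using p_gt_3 by simp
    then show ?thesis by (simp only: power_int_minus power_int_of_nat u_def inverse_eq_divide)
  qed
  have u_32: "32 ^ (p - 1) = u ^ 5"
  proof -
    have "(32 :: rat) ^ (p - 1) = (2 ^ 5) ^ (p - 1)" by simp
    also have "\<dots> = u ^ 5" by (simp only: u_def power_mult [symmetric] mult.commute)
    finally show ?thesis .
  qed
  have "u ^ 5 / u ^ 5 = 1" "u ^ 5 / u ^ 6 = 1 / u" "u ^ 5 / u ^ 4 = u"
    using u0 by (simp_all add: eval_nat_numeral)
  note u_quot = this
  show ?thesis
  proof (intro conjI)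
    show "rat_cong p 5
       (\<Sum>n=0..p - 1. ((2 * of_nat n + 1) ^ 3 - 5 * (2 * of_nat n + 1)) * (of_nat (S_seq n) ^ 2 / 32 ^ n))
       (- 4 * e * P ^ 2 + (24 * (e - 1) - 12 * E) * P ^ 4)"
      using one unfolding u_quot
      by (rule back_subst[where P = "rat_cong p 5 _"])
         (simp add: power2_eq_square power4_eq_xxxx algebra_simps)
    show "rat_cong p 5
       (\<Sum>n=0..p - 1. (18 * of_nat n ^ 3 - 21 * of_nat n ^ 2 - 18 * of_nat n - 4) * (of_nat (S_seq n) ^ 2 / 64 ^ n))
       (18 * P ^ 4 - e * P ^ 2 * (18 * P ^ 2 + 6 * P - 2) * 2 powi (1 - int p) + 6 * P ^ 4 * E)"
      using two unfolding u_quot u_powi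
      by (rule back_subst[where P = "rat_cong p 5 _"])
         (use u0 in \<open>simp add: power2_eq_square power4_eq_xxxx field_simps\<close>)
    show "rat_cong p 5
       (\<Sum>n=0..p - 1. (18 * of_nat n ^ 3 + 75 * of_nat n ^ 2 + 78 * of_nat n + 25) * (of_nat (S_seq n) ^ 2 / 16 ^ n))
       (45 * P ^ 4 - 4 * e * P ^ 2 * (9 * P ^ 2 - 3 * P - 1) * 2 ^ (p - 1) + 12 * P ^ 4 * E)"
      using three unfolding u_quot u_def [symmetric]
      by (rule back_subst[where P = "rat_cong p 5 _"])
         (simp add: power2_eq_square power4_eq_xxxx algebra_simps)
    show "rat_cong p 5
       (\<Sum>n=0..p - 1. (10634085 * of_nat n ^ 4 + 45622368 * of_nat n ^ 3
                      + 70689360 * of_nat n ^ 2 + 47911968 * of_nat n + 12084400) * of_nat (S_seq n) ^ 2)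
       (- 1024 * e * P ^ 2 * (1089 * P ^ 2 - 1023 * P + 299) * 32 ^ (p - 1)
          + (12458160 - 918528 * E) * P ^ 4)"
      using four unfolding u_32 power_one power_0 div_by_1
      by (rule back_subst[where P = "rat_cong p 5 _"])
         (simp add: power2_eq_square power4_eq_xxxx algebra_simps)
  qed
qed

end
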